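(* Let $N$ and $d$ be integers with $3 \leq d \leq N-1$. For any tree $T \in \mathcal{T}_{N,d}$, there is a tree $T' \in \mathcal{T}_{N,d-1}$ with $\mathcal{H}_2(T') < \mathcal{H}_2(T)$. Hence, the star $K_{1,N-1}$ has the smallest $\mathcal{H}_2$ norm of any tree with $N$ nodes; that is, $\mathcal{H}_2(K_{1,N-1}) \leq \mathcal{H}_2(T)$ for every tree $T$ with $N$ nodes.
   Context: All trees are finite, undirected, with unit weight on every edge. The distance between two nodes is the number of edges on the path joining them, and the diameter of a tree is the maximum distance between two of its nodes. $\mathcal{T}_{N,d}$ is the set of all trees with $N$ nodes and diameter $d$. $K_{1,N-1}$ is the star: one central node adjacent to each of the remaining $N-1$ nodes. $\mathcal{H}_2$ norm: for a connected undirected graph on $N$ nodes with Laplacian $L = D - A$ ($A$ the adjacency matrix, $D$ the diagonal matrix of degrees), let $0=\lambda_1 < \lambda_2 \leq \dots \leq \lambda_N$ be the eigenvalues of $L$. The $\mathcal{H}_2$ norm of the graph is $\mathcal{H}_2 = \left(\sum_{i=2}^{N}\frac{1}{2\lambda_i}\right)^{1/2}$. (This is the $\mathcal{H}_2$ norm of the system $\dot y = -QLQ^T y + Q\xi$ with output $z=y$, where the rows of $Q\in\mathbb{R}^{(N-1)\times N}$ form an orthonormal basis of the orthogonal complement of the all-ones vector.) *)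

theory Defs
  imports
    "Graph_Theory.Graph_Theory"
    "Jordan_Normal_Form.Char_Poly"
begin

text \<open>
  A finite simple undirected graph is a \<^locale>\<open>pair_graph\<close>: a finite, loop-free, symmetric
  digraph without parallel arcs. An undirected edge \<open>uv\<close> is the pair of arcs \<open>(u, v)\<close>, \<open>(v, u)\<close>.
  The library's \<open>tree\<close> does not fit this encoding, because it counts the closed walk
  \<open>[(u, v), (v, u)]\<close> as a cycle; the cycles of the undirected graph are the directed cycles of
  length at least 3.

  The nodes of a graph on \<open>N\<close> nodes are \<open>0, \<dots>, N - 1\<close>, which index its matrices.
\<close>

definition undirected_tree :: "'a pair_pre_digraph \<Rightarrow> bool" where
  "undirected_tree G \<longleftrightarrow> pair_graph G \<and> connected (with_proj G) \<and>
     \<not> (\<exists>p. pre_digraph.cycle (with_proj G) p \<and> 3 \<le> length p)"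

definition trees :: "nat \<Rightarrow> nat pair_pre_digraph set" where
  "trees N = {T. undirected_tree T \<and> pverts T = {0..<N}}"

text \<open>An \<^term>\<open>apath\<close> is a list of arcs, and in a tree it is determined by its end nodes.\<close>

definition tree_dist :: "'a pair_pre_digraph \<Rightarrow> 'a \<Rightarrow> 'a \<Rightarrow> nat" where
  "tree_dist T u v = length (THE p. pre_digraph.apath (with_proj T) u p v)"

definition tree_diameter :: "'a pair_pre_digraph \<Rightarrow> nat" where
  "tree_diameter T = Max {tree_dist T u v | u v. u \<in> pverts T \<and> v \<in> pverts T}"

definition trees_diam :: "nat \<Rightarrow> nat \<Rightarrow> nat pair_pre_digraph set" where
  "trees_diam N d = {T \<in> trees N. tree_diameter T = d}"

definition adjacency_matrix :: "nat pair_pre_digraph \<Rightarrow> real mat" where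
  "adjacency_matrix G =
     (let N = card (pverts G) in mat N N (\<lambda>(i, j). if (i, j) \<in> parcs G then 1 else 0))"

text \<open>In a symmetric digraph the out-degree of a node is its degree in the undirected graph.\<close>

definition degree_matrix :: "nat pair_pre_digraph \<Rightarrow> real mat" where
  "degree_matrix G =
     mat_diag (card (pverts G)) (\<lambda>i. real (out_degree (with_proj G) i))"

definition laplacian :: "nat pair_pre_digraph \<Rightarrow> real mat" where
  "laplacian G = degree_matrix G - adjacency_matrix G"

text \<open>
  The eigenvalues in ascending order, repeated according to their multiplicity as roots of the
  characteristic polynomial. List positions start at 0, so \<open>\<lambda>\<^sub>i\<close> is entry \<open>i - 1\<close>.
\<close>

definition laplacian_eigenvalues :: "nat pair_pre_digraph \<Rightarrow> real list" where
  "laplacian_eigenvalues G = sorted_list_of_multiset (proots (char_poly (laplacian G)))"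

definition H2_norm :: "nat pair_pre_digraph \<Rightarrow> real" where
  "H2_norm G =
     sqrt (\<Sum>i = 2..card (pverts G). 1 / (2 * laplacian_eigenvalues G ! (i - 1)))"

text \<open>
  The star is the library's complete bipartite graph with parts of size \<open>1\<close> and \<open>N - 1\<close>, with any
  of the \<open>N\<close> nodes as its centre.
\<close>

definition is_star :: "nat \<Rightarrow> nat pair_pre_digraph \<Rightarrow> bool" where
  "is_star N S \<longleftrightarrow> pverts S = {0..<N} \<and> complete_bipartite_digraph 1 (N - 1) (with_proj S)"

lemma is_star_exists:
  assumes "1 \<le> N"
  shows "\<exists>S. is_star N S"
proof -
  let ?S = "\<lparr>pverts = {0..<N}, parcs = {0} \<times> {1..<N} \<union> {1..<N} \<times> {0}\<rparr>"
  have "pverts ?S = {0} \<union> {1..<N}"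
    using assms by auto
  then have "\<exists>U V. pverts ?S = U \<union> V \<and> U \<inter> V = {} \<and> card U = 1 \<and> card V = N - 1 \<and>
      parcs ?S = U \<times> V \<union> V \<times> U"
    by - (rule exI[where x = "{0}"], rule exI[where x = "{1..<N}"], simp)
  then have "complete_bipartite_digraph 1 (N - 1) (with_proj ?S)"
    unfolding complete_bipartite_digraph_pair_def by simp
  then show ?thesis
    unfolding is_star_def by (intro exI[of _ ?S]) simp
qed

lemma is_star_tree:
  assumes "is_star N S"
  shows "S \<in> trees N"
proof -
  have K: "complete_bipartite_digraph 1 (N - 1) (with_proj S)" and V: "pverts S = {0..<N}"
    using assms by (auto simp: is_star_def)
  interpret pair_graph S
    using pair_graphI_complete_bipartite[OF K] .
  obtain c W where cW: "pverts S = {c} \<union> W" "c \<notin> W" "parcs S = {c} \<times> W \<union> W \<times> {c}"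
    using K unfolding complete_bipartite_digraph_pair_def by (auto simp: card_1_singleton_iff)
  have toc: "u \<rightarrow>\<^sup>*\<^bsub>with_proj S\<^esub> c" and fromc: "c \<rightarrow>\<^sup>*\<^bsub>with_proj S\<^esub> u" if "u \<in> pverts S" for u
  proof -
    have "u = c \<or> (u, c) \<in> parcs S \<and> (c, u) \<in> parcs S"
      using that cW by blast
    then show "u \<rightarrow>\<^sup>*\<^bsub>with_proj S\<^esub> c" and "c \<rightarrow>\<^sup>*\<^bsub>with_proj S\<^esub> u"
      using that reachable_refl[of c] reachable_adjI[of u c] reachable_adjI[of c u] by auto
  qed
  have "strongly_connected (with_proj S)"
    unfolding strongly_connected_def
  proof (intro conjI ballI)
    show "verts (with_proj S) \<noteq> {}"
      using cW by simp
  next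
    fix u v
    assume "u \<in> verts (with_proj S)" and "v \<in> verts (with_proj S)"
    then show "u \<rightarrow>\<^sup>*\<^bsub>with_proj S\<^esub> v"
      using reachable_trans[OF toc[of u] fromc[of v]] by simp
  qed
  then have con: "connected (with_proj S)"
    unfolding connected_def strongly_connected_def
    using reachable_mk_symmetricI by auto
  have acyc: "\<not> (cycle p \<and> 3 \<le> length p)" for p
  proof
    assume *: "cycle p \<and> 3 \<le> length p"
    then obtain u where u: "awalk u p u" "distinct (tl (awalk_verts u p))"
      by (auto simp: cycle_def)
    have arc: "a = c \<and> b \<in> W \<or> a \<in> W \<and> b = c" if "(a, b) \<in> parcs S" for a b
      using that cW(3) by auto
    have walk: "set p \<subseteq> parcs S" "pcas u p u" "distinct (tl (pawalk_verts u p))"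
      using u by (simp_all add: awalk_def)
    obtain e1 e2 e3 q where p: "p = e1 # e2 # e3 # q"
      using * by (auto simp: numeral_3_eq_3 Suc_le_length_iff)
    obtain v0 v1 v2 v3 where e: "e1 = (v0, v1)" "e2 = (v1, v2)" "e3 = (v2, v3)"
      using walk(2) unfolding p by (cases e1; cases e2; cases e3) simp
    have in_arcs: "(v0, v1) \<in> parcs S" "(v1, v2) \<in> parcs S" "(v2, v3) \<in> parcs S"
      using walk(1) unfolding p e by simp_all
    have dist: "v1 \<noteq> v2" "v1 \<notin> set (pawalk_verts v3 q)" "v2 \<notin> set (pawalk_verts v3 q)"
      using walk(3) unfolding p e by simp_all
    show False
    proof (cases q)
      case Nil
      then have "v3 = v0"
        using walk(2) unfolding p e by simp
      then show False
        using dist Nil arc[OF in_arcs(1)] arc[OF in_arcs(2)] arc[OF in_arcs(3)] cW(2) by auto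
    next
      case (Cons e4 r)
      obtain v4 where e4: "e4 = (v3, v4)"
        using walk(2) unfolding p e Cons by (cases e4) simp
      have "(v3, v4) \<in> parcs S"
        using walk(1) unfolding p Cons e4 by simp
      moreover have "v3 \<in> set (pawalk_verts v3 q)" "v4 \<in> set (pawalk_verts v3 q)"
        unfolding Cons e4 by (simp, cases r, simp_all, use walk(2) in \<open>simp add: p e Cons e4\<close>)
      ultimately show False
        using dist arc[of v3 v4] arc[OF in_arcs(2)] arc[OF in_arcs(3)] cW(2) by metis
    qed
  qed
  show ?thesis
    using con acyc V pair_graph by (auto simp: trees_def undirected_tree_def)
qed

end

theory Submission
  imports Defs "Jordan_Normal_Form.Schur_Decomposition"
begin

text \<open>
  For a fixed number \<open>N\<close> of nodes, the \<open>H\<^sub>2\<close> norm of a tree increases with the sum \<open>W\<close> of its distances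
  over all ordered pairs of nodes: \<open>H\<^sub>2(T)\<^sup>2 = W(T) / (4N)\<close>. Given this formula, both claims are
  about distance sums.

  The formula comes from an explicit inverse. Among the neighbours of a node \<open>i \<noteq> j\<close>
  of a tree exactly one is closer to \<open>j\<close>, by one, and all the others are farther, by one. Hence the
  Laplacian \<open>L\<close> and the distance matrix \<open>D\<close> satisfy \<open>L D = \<tau> 1\<^sup>T - 2 I\<close> with \<open>\<tau> = 2 - deg\<close>. Centring the
  rows and columns of \<open>- D / 2\<close> therefore gives the pseudo-inverse of \<open>L\<close>, and adding \<open>J / N\<close>, with \<open>J\<close>
  the all-ones matrix, turns it into the inverse of \<open>L + J / N\<close>. The trace of that inverse is
  \<open>1 + W / (2N)\<close>. On the other hand, \<open>L + J / N\<close> has the eigenvalues of \<open>L\<close> except that the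
  eigenvalue 0 is replaced by 1, so the trace is also \<open>1\<close> plus the sum of the inverses of the nonzero
  eigenvalues of \<open>L\<close> (\<open>sum_inverse_nonzero_eigenvalues\<close>, \<open>H2_norm_eq_sum_dist\<close>).

  To shrink the diameter, take an edge \<open>xy\<close> none of whose ends is a leaf, and hang all the neighbours of
  \<open>y\<close> other than \<open>x\<close> on \<open>x\<close>, so that \<open>y\<close> becomes a leaf. A node on the side of \<open>x\<close> and a node other
  than \<open>y\<close> on the side of \<open>y\<close> move closer by one; only \<open>y\<close> and the other nodes on its side move
  apart, by one, and their new distances were the distances to \<open>x\<close> before. So \<open>W\<close>
  decreases (\<open>sum_contracted_dist\<close>), while the diameter does not increase and drops by at most one
  (\<open>contracted_dist_bounds\<close>). A tree of diameter at least 3 has such an edge, and since \<open>W\<close> is a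
  natural number, repeating the step must at some point lower the diameter, by exactly one
  (\<open>reduce_diameter\<close>).

  For the star, count: a tree has \<open>2(N - 1)\<close> arcs, whose ends are at distance 1, and all other ordered
  pairs of distinct nodes are at distance at least 2. In the star these distances are exactly 2.
\<close>

section \<open>Spectrum and inverse trace of a symmetric matrix with constant kernel\<close>

lemma mat_mult_entry:
  assumes "A \<in> carrier_mat n n" "B \<in> carrier_mat n n" "i < n" "j < n"
  shows "(A * B) $$ (i, j) = (\<Sum>k<n. A $$ (i, k) * B $$ (k, j))"
  using assms by (simp add: scalar_prod_def atLeast0LessThan)

lemma mat_mult_vec_entry:
  assumes "A \<in> carrier_mat n n" "v \<in> carrier_vec n" "i < n"
  shows "(A *\<^sub>v v) $ i = (\<Sum>k<n. A $$ (i, k) * v $ k)"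
  using assms by (simp add: scalar_prod_def atLeast0LessThan)

lemma trace_similar:
  fixes A :: "'a :: comm_ring_1 mat"
  assumes A: "A \<in> carrier_mat n n" and P: "P \<in> carrier_mat n n" and Q: "Q \<in> carrier_mat n n"
    and PQ: "P * Q = 1\<^sub>m n"
  shows "(\<Sum>i<n. (Q * A * P) $$ (i, i)) = (\<Sum>i<n. A $$ (i, i))"
proof -
  have QA: "Q * A \<in> carrier_mat n n"
    using A Q by simp
  have "(\<Sum>i<n. (Q * A * P) $$ (i, i)) = (\<Sum>i<n. \<Sum>k<n. (Q * A) $$ (i, k) * P $$ (k, i))"
    by (rule sum.cong) (use mat_mult_entry[OF QA P] in auto)
  also have "\<dots> = (\<Sum>k<n. \<Sum>i<n. P $$ (k, i) * (Q * A) $$ (i, k))"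
    by (subst sum.swap) (simp add: mult.commute)
  also have "\<dots> = (\<Sum>k<n. (P * (Q * A)) $$ (k, k))"
    by (rule sum.cong) (use mat_mult_entry[OF P QA] in auto)
  also have "P * (Q * A) = A"
    using assoc_mult_mat[OF P Q A] PQ A by simp
  finally show ?thesis .
qed

text \<open>
  Back substitution: in the product of row \<open>i\<close> of \<open>B\<close> with column \<open>j\<close> of \<open>Y\<close>, the entries of that column below
  row \<open>i\<close> are known to vanish, so its entry in row \<open>i\<close> is the only unknown left.
\<close>

lemma upper_triangular_inverse_below_diagonal:
  fixes B :: "'a :: field mat"
  assumes B: "B \<in> carrier_mat n n" and Y: "Y \<in> carrier_mat n n"
    and ut: "upper_triangular B" and BY: "B * Y = 1\<^sub>m n"
    and diag: "\<And>i. i < n \<Longrightarrow> B $$ (i, i) \<noteq> 0"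
    and "i < n" "j < i"
  shows "Y $$ (i, j) = 0"
  using \<open>i < n\<close> \<open>j < i\<close>
proof (induction "n - i" arbitrary: i rule: less_induct)
  case less
  have "0 = (B * Y) $$ (i, j)"
    using less.prems BY by simp
  also have "\<dots> = (\<Sum>k<n. B $$ (i, k) * Y $$ (k, j))"
    using less.prems by (intro mat_mult_entry[OF B Y]) auto
  also have "\<dots> = (\<Sum>k\<in>{i}. B $$ (i, k) * Y $$ (k, j))"
  proof (rule sum.mono_neutral_right)
    show "\<forall>k\<in>{..<n} - {i}. B $$ (i, k) * Y $$ (k, j) = 0"
    proof
      fix k assume k: "k \<in> {..<n} - {i}"
      show "B $$ (i, k) * Y $$ (k, j) = 0"
      proof (cases "k < i")
        case True
        then show ?thesis
          using upper_triangularD[OF ut] less.prems B by simp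
      next
        case False
        then show ?thesis
          using k less by auto
      qed
    qed
  qed (use less.prems in auto)
  finally show ?case
    using diag[OF less.prems(1)] by simp
qed

lemma upper_triangular_inverse_diagonal:
  fixes B :: "'a :: field mat"
  assumes B: "B \<in> carrier_mat n n" and Y: "Y \<in> carrier_mat n n"
    and ut: "upper_triangular B" and BY: "B * Y = 1\<^sub>m n" and i: "i < n"
  shows "B $$ (i, i) \<noteq> 0" and "Y $$ (i, i) = 1 / B $$ (i, i)"
proof -
  have "det B * det Y = 1"
    using det_mult[OF B Y] BY by simp
  then have "det B \<noteq> 0"
    by auto
  then have "0 \<notin> set (diag_mat B)"
    unfolding det_upper_triangular[OF ut B] prod_list_zero_iff .
  then have diag: "B $$ (i, i) \<noteq> 0" if "i < n" for i
    using that B by (auto simp: diag_mat_def)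
  show nz: "B $$ (i, i) \<noteq> 0"
    using diag i .
  have "1 = (B * Y) $$ (i, i)"
    using i BY by simp
  also have "\<dots> = (\<Sum>k<n. B $$ (i, k) * Y $$ (k, i))"
    using i by (intro mat_mult_entry[OF B Y]) auto
  also have "\<dots> = (\<Sum>k\<in>{i}. B $$ (i, k) * Y $$ (k, i))"
  proof (rule sum.mono_neutral_right)
    show "\<forall>k\<in>{..<n} - {i}. B $$ (i, k) * Y $$ (k, i) = 0"
      using upper_triangularD[OF ut] upper_triangular_inverse_below_diagonal[OF B Y ut BY diag] i B
      by (metis DiffD1 DiffD2 carrier_matD(1) lessThan_iff linorder_neqE_nat mult_zero_left
          mult_zero_right singletonI)
  qed (use i in auto)
  finally show "Y $$ (i, i) = 1 / B $$ (i, i)"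
    using nz by (simp add: field_simps)
qed

text \<open>
  For an eigenvector \<open>v\<close> the number \<open>v\<^sup>* A v = a \<parallel>v\<parallel>\<^sup>2\<close> equals its own conjugate, since \<open>A\<close> is real and
  symmetric.
\<close>

lemma symmetric_mat_complex_eigenvalue_real:
  fixes A :: "real mat" and a :: complex
  assumes A: "A \<in> carrier_mat n n" and sym: "\<And>i j. i < n \<Longrightarrow> j < n \<Longrightarrow> A $$ (i, j) = A $$ (j, i)"
    and ev: "eigenvalue (map_mat of_real A) a"
  shows "a \<in> \<real>"
proof -
  let ?A = "map_mat complex_of_real A"
  have cA: "?A \<in> carrier_mat n n"
    using A by simp
  from ev obtain v where v: "v \<in> carrier_vec n" "v \<noteq> 0\<^sub>v n" "?A *\<^sub>v v = a \<cdot>\<^sub>v v"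
    using A by (auto simp: eigenvalue_def eigenvector_def)
  define s where "s = (\<Sum>i<n. \<Sum>j<n. cnj (v $ i) * of_real (A $$ (i, j)) * v $ j)"
  define m where "m = (\<Sum>i<n. (cmod (v $ i))\<^sup>2)"
  have row: "(\<Sum>j<n. of_real (A $$ (i, j)) * v $ j) = a * v $ i" if "i < n" for i
  proof -
    have "(?A *\<^sub>v v) $ i = (\<Sum>j<n. of_real (A $$ (i, j)) * v $ j)"
      using mat_mult_vec_entry[OF cA v(1) that] that A by simp
    then show ?thesis
      using v that by simp
  qed
  have "s = (\<Sum>i<n. cnj (v $ i) * (a * v $ i))"
    unfolding s_def by (rule sum.cong) (simp_all add: row[symmetric] sum_distrib_left mult.assoc)
  also have "\<dots> = a * of_real m"
    unfolding m_def of_real_sum sum_distrib_left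
    by (rule sum.cong) (simp_all add: complex_norm_square mult_ac del: of_real_power)
  finally have s: "s = a * of_real m" .
  have "cnj s = (\<Sum>i<n. \<Sum>j<n. v $ i * of_real (A $$ (i, j)) * cnj (v $ j))"
    unfolding s_def by simp
  also have "\<dots> = (\<Sum>j<n. \<Sum>i<n. v $ i * of_real (A $$ (i, j)) * cnj (v $ j))"
    by (rule sum.swap)
  also have "\<dots> = s"
    unfolding s_def by (intro sum.cong refl) (simp add: sym mult_ac)
  finally have "cnj a * of_real m = a * of_real m"
    using s by simp
  moreover have "m \<noteq> 0"
  proof -
    obtain i where "i < n" "v $ i \<noteq> 0"
      using v by (metis carrier_vecD eq_vecI index_zero_vec)
    then show ?thesis
      unfolding m_def by (subst sum_nonneg_eq_0_iff) auto
  qed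
  ultimately have "cnj a = a"
    by simp
  then show ?thesis
    by (simp add: Reals_cnj_iff)
qed

text \<open>
  The complex linear factors are real, and the embedding of the real polynomials is injective. A
  splitting characteristic polynomial is what the Schur decomposition over the reals requires.
\<close>

lemma symmetric_mat_char_poly_splits:
  fixes A :: "real mat"
  assumes A: "A \<in> carrier_mat n n" and sym: "\<And>i j. i < n \<Longrightarrow> j < n \<Longrightarrow> A $$ (i, j) = A $$ (j, i)"
  shows "\<exists>es. char_poly A = (\<Prod>e\<leftarrow>es. [:- e, 1:])"
proof -
  let ?A = "map_mat complex_of_real A"
  have cA: "?A \<in> carrier_mat n n"
    using A by simp
  obtain as where as: "char_poly ?A = (\<Prod>a\<leftarrow>as. [:- a, 1:])"
    using char_poly_factorized[OF cA] by blast
  have "a \<in> \<real>" if "a \<in> set as" for a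
  proof (rule symmetric_mat_complex_eigenvalue_real[OF A sym])
    have "poly (char_poly ?A) a = 0"
      unfolding as poly_prod_list prod_list_zero_iff using that by force
    then show "eigenvalue ?A a"
      using eigenvalue_root_char_poly[OF cA] by simp
  qed
  then have "set as \<subseteq> range complex_of_real"
    by (auto simp: Reals_def)
  then obtain es where es: "as = map complex_of_real es"
    by (metis ex_map_conv image_iff subset_iff)
  interpret of_real: map_poly_inj_comm_ring_hom complex_of_real ..
  have "map_poly complex_of_real (char_poly A) = char_poly ?A"
    by (rule of_real_hom.char_poly_hom[OF A, symmetric])
  also have "\<dots> = map_poly complex_of_real (\<Prod>e\<leftarrow>es. [:- e, 1:])"
    unfolding as es by (simp add: of_real.hom_prod_list o_def)
  finally have "char_poly A = (\<Prod>e\<leftarrow>es. [:- e, 1:])"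
    by simp
  then show ?thesis ..
qed

lemma eigenvalue_nonneg_if_positive_semidefinite:
  fixes A :: "real mat"
  assumes A: "A \<in> carrier_mat n n" and psd: "\<And>v. v \<in> carrier_vec n \<Longrightarrow> 0 \<le> v \<bullet> (A *\<^sub>v v)"
    and ev: "eigenvalue A e"
  shows "0 \<le> e"
proof -
  from ev obtain v where v: "v \<in> carrier_vec n" "v \<noteq> 0\<^sub>v n" "A *\<^sub>v v = e \<cdot>\<^sub>v v"
    using A by (auto simp: eigenvalue_def eigenvector_def)
  have "0 \<le> e * (v \<bullet> v)"
    using psd[OF v(1)] v by simp
  moreover have "0 < v \<bullet> v"
    using conjugate_square_greater_0_vec[OF v(1)] v by simp
  ultimately show ?thesis
    by (simp add: zero_le_mult_iff)
qed

text \<open>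
  Let \<open>Y\<close> be the inverse of \<open>L + J\<close>, where \<open>J\<close> projects onto the constant vectors. In a Schur basis
  of \<open>L\<close> that lists the eigenvalue 0 first, \<open>L + J\<close> stays triangular and its diagonal is that of \<open>L\<close>
  with the leading 0 replaced by 1. The inverse of a triangular matrix has the inverse diagonal, and
  the trace does not depend on the basis. Invertibility also shows that 0 is a simple eigenvalue,
  without which the quotients on the left would not be meaningful.
\<close>

lemma sum_inverse_nonzero_eigenvalues:
  fixes L Y :: "real mat" and n :: nat
  defines "es \<equiv> sorted_list_of_multiset (proots (char_poly L))"
    and "J \<equiv> mat n n (\<lambda>_. 1 / real n)"
  assumes L: "L \<in> carrier_mat n n" and n: "0 < n"
    and sym: "\<And>i j. i < n \<Longrightarrow> j < n \<Longrightarrow> L $$ (i, j) = L $$ (j, i)"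
    and psd: "\<And>v. v \<in> carrier_vec n \<Longrightarrow> 0 \<le> v \<bullet> (L *\<^sub>v v)"
    and row_sum: "\<And>i. i < n \<Longrightarrow> (\<Sum>j<n. L $$ (i, j)) = 0"
    and Y: "Y \<in> carrier_mat n n" and inv: "(L + J) * Y = 1\<^sub>m n"
  shows "(\<Sum>i=2..n. 1 / es ! (i - 1)) = (\<Sum>i<n. Y $$ (i, i)) - 1"
proof -
  have J: "J \<in> carrier_mat n n" and LJ: "L + J \<in> carrier_mat n n"
    using L by (auto simp: J_def)
  obtain es0 where es0: "char_poly L = (\<Prod>e\<leftarrow>es0. [:- e, 1:])"
    using symmetric_mat_char_poly_splits[OF L sym] by blast
  have "proots (char_poly L) = mset es0"
    unfolding es0
  proof (induction es0)
    case (Cons e es0)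
    have "(\<Prod>e\<leftarrow>es0. [:- e, 1:]) \<noteq> 0"
      by (simp only: prod_list_zero_iff) auto
    with Cons show ?case
      by (simp add: proots_mult del: mult_pCons_left)
  qed simp
  then have mset_es: "mset es = mset es0" and sorted: "sorted es"
    by (simp_all add: es_def)
  have "char_poly L = prod_mset (image_mset (\<lambda>e. [:- e, 1:]) (mset es))"
    unfolding es0 mset_es by (simp flip: prod_mset_prod_list)
  then have es: "char_poly L = (\<Prod>e\<leftarrow>es. [:- e, 1:])"
    by (simp flip: prod_mset_prod_list)
  have len: "length es = n"
    using degree_monic_char_poly[OF L] degree_linear_factors[of uminus es] es by simp
  have ev_iff: "eigenvalue L e \<longleftrightarrow> e \<in> set es" for e
    unfolding eigenvalue_root_char_poly[OF L] es poly_prod_list prod_list_zero_iff by force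
  define ones :: "real vec" where "ones = vec n (\<lambda>_. 1)"
  have ones: "ones \<in> carrier_vec n"
    by (simp add: ones_def)
  have L_ones: "L *\<^sub>v ones = 0\<^sub>v n"
    by (rule eq_vecI) (use L row_sum in \<open>simp_all add: scalar_prod_def ones_def atLeast0LessThan\<close>)
  have "ones \<noteq> 0\<^sub>v n"
    using n by (metis index_vec index_zero_vec(1) ones_def zero_neq_one)
  then have "eigenvalue L 0"
    using L ones L_ones by (auto simp: eigenvalue_def eigenvector_def intro!: exI[of _ ones])
  then have "0 \<in> set es"
    using ev_iff by simp
  moreover have nonneg: "0 \<le> e" if "e \<in> set es" for e
    using eigenvalue_nonneg_if_positive_semidefinite[OF L psd] that ev_iff by blast
  ultimately have es_0: "es ! 0 = 0"
    using sorted n len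
    by (metis antisym in_set_conv_nth le0 nth_mem sorted_nth_mono)

  obtain B P Q where "schur_decomposition L es = (B, P, Q)"
    by (cases "schur_decomposition L es") auto
  from schur_decomposition[OF L es this]
  have sim: "similar_mat_wit L B P Q" and ut: "upper_triangular B" and diag: "diag_mat B = es"
    by auto
  from similar_mat_witD2[OF L sim]
  have PQ: "P * Q = 1\<^sub>m n" and QP: "Q * P = 1\<^sub>m n" and LPBQ: "L = P * B * Q"
    and B: "B \<in> carrier_mat n n" and P: "P \<in> carrier_mat n n" and Q: "Q \<in> carrier_mat n n"
    by auto
  have diag_B: "B $$ (i, i) = es ! i" if "i < n" for i
    using that diag B by (auto simp: diag_mat_def)
  have QLP: "Q * L * P = B"
  proof -
    have "Q * L * P = Q * (P * B * Q) * P"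
      using LPBQ by simp
    also have "\<dots> = (Q * P) * B * (Q * P)"
      using P Q B by (simp add: assoc_mult_mat[of _ n n _ n _ n])
    finally show ?thesis
      using QP B by simp
  qed
  \<comment> \<open>The first column of \<open>P\<close> spans the kernel of \<open>L\<close>, so it is a constant vector.\<close>
  define w where "w = col P 0"
  have w: "w \<in> carrier_vec n"
    using P n unfolding w_def by (intro col_carrier_vec) auto
  have "L * P = P * B"
    using LPBQ P Q B QP by (simp add: assoc_mult_mat[of _ n n _ n _ n])
  then have "L *\<^sub>v w = col (P * B) 0"
    unfolding w_def using L P n by (metis carrier_matD(2) col_mult2)
  also have "\<dots> = P *\<^sub>v col B 0"
    using P B n by (intro col_mult2) auto
  also have "col B 0 = 0\<^sub>v n"
  proof (rule eq_vecI)
    fix i assume "i < dim_vec (0\<^sub>v n :: real vec)"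
    then show "col B 0 $ i = 0\<^sub>v n $ i"
      using B n upper_triangularD[OF ut, of 0 i] diag_B[of 0] es_0 by (cases "i = 0") auto
  qed (use B in auto)
  also have "P *\<^sub>v 0\<^sub>v n = 0\<^sub>v n"
    using P by (intro eq_vecI) auto
  finally have Lw: "L *\<^sub>v w = 0\<^sub>v n" .
  define c where "c = (\<Sum>i<n. w $ i) / n"
  have Jv: "J *\<^sub>v v = ((\<Sum>i<n. v $ i) / n) \<cdot>\<^sub>v ones" if "v \<in> carrier_vec n" for v
    by (rule eq_vecI)
      (use that in \<open>auto simp: J_def ones_def scalar_prod_def atLeast0LessThan sum_divide_distrib\<close>)
  have "(\<Sum>i<n. ones $ i) = real n"
    by (simp add: ones_def)
  then have "(L + J) *\<^sub>v ones = ones"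
    using add_mult_distrib_mat_vec[OF L J ones] Jv[OF ones] L_ones n ones by simp
  moreover have Y_inv: "Y *\<^sub>v ((L + J) *\<^sub>v v) = v" if "v \<in> carrier_vec n" for v
    using mat_mult_left_right_inverse[OF LJ Y inv] assoc_mult_mat_vec[OF Y LJ that] that by simp
  ultimately have Y_ones: "Y *\<^sub>v ones = ones"
    using ones by metis
  have "(L + J) *\<^sub>v w = c \<cdot>\<^sub>v ones"
    using add_mult_distrib_mat_vec[OF L J w] Jv[OF w] Lw ones by (simp add: c_def)
  then have "w = c \<cdot>\<^sub>v ones"
    using Y_inv[OF w] Y_ones mult_mat_vec[OF Y ones] by simp
  then have P_0: "P $$ (i, 0) = c" if "i < n" for i
    using that P n by (metis (no_types, lifting) carrier_matD(1,2) index_col index_smult_vec(1)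
        index_vec mult.right_neutral ones carrier_vecD ones_def w_def)
  \<comment> \<open>Hence adding \<open>J\<close> changes only the first row of the triangular form.\<close>
  define q where "q i = (\<Sum>k<n. Q $$ (i, k))" for i
  have qc: "q i * c = (if i = 0 then 1 else 0)" if "i < n" for i
  proof -
    have "q i * c = (Q * P) $$ (i, 0)"
      using mat_mult_entry[OF Q P that n] P_0 by (simp add: q_def sum_distrib_right)
    then show ?thesis
      using QP that n by simp
  qed
  then have "c \<noteq> 0"
    using n by fastforce
  then have q: "q i = (if i = 0 then 1 / c else 0)" if "i < n" for i
    using qc[OF that] by (auto simp: field_simps split: if_splits)
  have QJ: "(Q * J) $$ (i, k) = q i / n" if "i < n" "k < n" for i k
    using mat_mult_entry[OF Q J that] that by (simp add: J_def q_def sum_divide_distrib)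
  have QJP: "(Q * J * P) $$ (i, j) = q i / n * (\<Sum>k<n. P $$ (k, j))" if "i < n" "j < n" for i j
  proof -
    have "Q * J \<in> carrier_mat n n"
      using Q J by simp
    from mat_mult_entry[OF this P that] show ?thesis
      using that QJ by (simp add: sum_distrib_left)
  qed
  define B1 where "B1 = Q * (L + J) * P"
  have B1_eq: "B1 = B + Q * J * P"
    unfolding B1_def using Q L J P QLP
    by (simp add: mult_add_distrib_mat[of _ n n _ n] add_mult_distrib_mat[of _ n n _ _ n])
  have B1: "B1 \<in> carrier_mat n n"
    using Q LJ P by (simp add: B1_def)
  have B1_row: "B1 $$ (i, j) = B $$ (i, j)" if "0 < i" "i < n" "j < n" for i j
    using that B P Q J QJP[of i j] q[of i] by (simp add: B1_eq)
  have B1_00: "B1 $$ (0, 0) = 1"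
    using n B P Q J QJP[of 0 0] q[of 0] P_0 diag_B[of 0] es_0 \<open>c \<noteq> 0\<close> by (simp add: B1_eq)
  have ut1: "upper_triangular B1"
    using upper_triangularD[OF ut] B1 B B1_row by (intro upper_triangularI) auto
  define Y1 where "Y1 = Q * Y * P"
  have Y1: "Y1 \<in> carrier_mat n n"
    using Q Y P by (simp add: Y1_def)
  have "B1 * Y1 = Q * ((L + J) * (P * Q) * Y) * P"
    unfolding B1_def Y1_def using Q P Y LJ
    by (simp add: assoc_mult_mat[of _ n n _ n _ n] mult_carrier_mat[of _ n n _ n])
  also have "\<dots> = Q * 1\<^sub>m n * P"
    by (simp only: PQ right_mult_one_mat[OF LJ] inv)
  finally have "B1 * Y1 = 1\<^sub>m n"
    using Q QP by simp
  note Y1_diag = upper_triangular_inverse_diagonal(2)[OF B1 Y1 ut1 this]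
  have "(\<Sum>i<n. Y $$ (i, i)) = (\<Sum>i<n. Y1 $$ (i, i))"
    unfolding Y1_def by (rule trace_similar[OF Y P Q PQ, symmetric])
  also have "\<dots> = (\<Sum>i<n. 1 / B1 $$ (i, i))"
    using Y1_diag by simp
  also have "\<dots> = 1 / B1 $$ (0, 0) + (\<Sum>i\<in>{1..<n}. 1 / B1 $$ (i, i))"
    using n by (simp add: lessThan_atLeast0 sum.atLeast_Suc_lessThan)
  also have "(\<Sum>i\<in>{1..<n}. 1 / B1 $$ (i, i)) = (\<Sum>i=2..n. 1 / es ! (i - 1))"
    by (rule sum.reindex_bij_witness[of _ "\<lambda>i. i - 1" Suc]) (use B1_row diag_B in auto)
  finally show ?thesis
    using B1_00 by simp
qed

section \<open>Trees as integer metrics\<close>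

text \<open>
  The local form of the distance function of a tree: seen from \<open>j\<close>, every other node has one
  neighbour that is closer, and its remaining neighbours are farther. For a nonempty graph with
  finitely many nodes these axioms characterise trees together with their distances; they are easier
  to transport through a change of the arcs than acyclicity and paths.
\<close>

locale tree_metric =
  fixes V :: "'a set" and E :: "'a rel" and D :: "'a \<Rightarrow> 'a \<Rightarrow> nat"
  assumes arcs_in_verts: "E \<subseteq> V \<times> V"
    and arc_sym: "(i, k) \<in> E \<Longrightarrow> (k, i) \<in> E"
    and arc_irrefl: "(i, i) \<notin> E"
    and dist_self: "i \<in> V \<Longrightarrow> D i i = 0"
    and dist_sym: "i \<in> V \<Longrightarrow> j \<in> V \<Longrightarrow> D i j = D j i"
    and ex_unique_closer: "i \<in> V \<Longrightarrow> j \<in> V \<Longrightarrow> i \<noteq> j \<Longrightarrow>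
      \<exists>k. (i, k) \<in> E \<and> D i j = Suc (D k j) \<and> (\<forall>k'. (i, k') \<in> E \<and> k' \<noteq> k \<longrightarrow> D k' j = Suc (D i j))"
begin

lemma arc_verts:
  assumes "(i, k) \<in> E"
  shows "i \<in> V" "k \<in> V"
  using assms arcs_in_verts by auto

lemma dist_eq_0_iff: "i \<in> V \<Longrightarrow> j \<in> V \<Longrightarrow> D i j = 0 \<longleftrightarrow> i = j"
  using ex_unique_closer[of i j] dist_self by fastforce

lemma closer_unique:
  assumes "(i, k) \<in> E" "(i, k') \<in> E" "j \<in> V" "D k j < D i j" "D k' j < D i j"
  shows "k = k'"
proof -
  have "i \<noteq> j"
    using assms dist_self by auto
  then show ?thesis
    using ex_unique_closer[of i j] assms arc_verts by (metis Suc_lessD less_irrefl)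
qed

lemma arc_dist_cases:
  assumes "(i, k) \<in> E" "j \<in> V"
  shows "D k j = Suc (D i j) \<or> D i j = Suc (D k j)"
proof (cases "i = j")
  case True
  then have "k \<noteq> j"
    using assms arc_irrefl by auto
  then obtain m where "D k j = Suc (D m j)" "m = j \<or> D j j = Suc (D k j)"
    using ex_unique_closer[of k j] assms arc_verts arc_sym True by metis
  then show ?thesis
    using True dist_self assms by auto
next
  case False
  then show ?thesis
    using ex_unique_closer[of i j] assms arc_verts by metis
qed

lemma arc_dist:
  assumes "(i, k) \<in> E"
  shows "D i k = 1"
  using arc_dist_cases[OF assms, of k] assms arc_verts dist_self by auto

lemma closer_neighbour:
  assumes "i \<in> V" "j \<in> V" "i \<noteq> j"
  obtains k where "(i, k) \<in> E" "D i j = Suc (D k j)"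
  using ex_unique_closer[OF assms] by blast

lemma other_neighbour_farther:
  assumes "(i, k) \<in> E" "(i, k') \<in> E" "j \<in> V" "D k j < D i j" "k' \<noteq> k"
  shows "D k' j = Suc (D i j)"
  using assms closer_unique[of i k k' j] arc_dist_cases[of i k' j] by fastforce

end

locale graph_tree_metric = pair_graph G + tree_metric "pverts G" "parcs G" D
  for G :: "'a pair_pre_digraph" and D
begin

text \<open>
  Followed backwards from its end \<open>v\<close>, a path gains one unit of distance to \<open>v\<close> at each step:
  the one closer neighbour of a node is its successor on the path, and a path does not return to it.
\<close>

lemma length_apath_eq_dist:
  assumes "apath u p v"
  shows "length p = D u v"
  using assms
proof (induction p arbitrary: u rule: length_induct)
  case (1 p)
  show ?case
  proof (cases p)
    case Nil
    then have "u = v" "u \<in> pverts G"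
      using 1 by (auto simp: apath_Nil_iff)
    then show ?thesis
      using Nil dist_self by simp
  next
    case p: (Cons e q)
    then obtain w where e: "e = (u, w)"
      using 1 by (cases e) (auto simp: apath_Cons_iff)
    have uw: "(u, w) \<in> parcs G" and q: "apath w q v" and u: "u \<notin> set (pawalk_verts w q)"
      using 1 by (auto simp: apath_Cons_iff p e)
    have len_q: "length q = D w v"
      using 1 q p by simp
    have v: "v \<in> pverts G"
      using q awalk_last_in_verts by (auto simp: apath_def)
    have "D u v = Suc (D w v)"
    proof (cases q)
      case Nil
      then have "w = v"
        using q by (simp add: apath_Nil_iff)
      then show ?thesis
        using arc_dist[OF uw] dist_self[OF v] by simp
    next
      case q': (Cons e' r)
      then obtain w' where e': "e' = (w, w')"
        using q by (cases e') (auto simp: apath_Cons_iff)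
      have ww': "(w, w') \<in> parcs G" and r: "apath w' r v"
        using q by (auto simp: apath_Cons_iff q' e')
      have "length r = D w' v"
        using 1 r p q' by simp
      then have "D w' v < D w v"
        using len_q q' by simp
      moreover have "u \<noteq> w'"
        using u hd_in_awalk_verts(2)[OF r] by (auto simp: q' e')
      ultimately show ?thesis
        using other_neighbour_farther[of w w' u v] ww' arc_sym[OF uw] v by simp
    qed
    then show ?thesis
      using len_q p by simp
  qed
qed

lemma apath_unique:
  assumes "apath u p v" "apath u q v"
  shows "p = q"
  using assms
proof (induction p arbitrary: u q)
  case Nil
  then show ?case
    using length_apath_eq_dist[of u "[]" v] length_apath_eq_dist[of u q v] by simp
next
  case (Cons e p)
  obtain e' q' where q: "q = e' # q'"
    using length_apath_eq_dist[OF Cons.prems(1)] length_apath_eq_dist[OF Cons.prems(2)]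
    by (cases q) auto
  obtain w w' where e: "e = (u, w)" "e' = (u, w')"
    using Cons.prems by (cases e; cases e') (auto simp: apath_Cons_iff q)
  have arcs: "(u, w) \<in> parcs G" "(u, w') \<in> parcs G" and paths: "apath w p v" "apath w' q' v"
    using Cons.prems by (auto simp: apath_Cons_iff q e)
  have "D w v < D u v" "D w' v < D u v"
    using length_apath_eq_dist[OF Cons.prems(1)] length_apath_eq_dist[OF Cons.prems(2)]
      length_apath_eq_dist[OF paths(1)] length_apath_eq_dist[OF paths(2)] by (simp_all add: q)
  moreover have "v \<in> pverts G"
    using paths awalk_last_in_verts by (auto simp: apath_def)
  ultimately have "w = w'"
    using closer_unique arcs by blast
  then show ?case
    using Cons.IH paths by (simp add: e q)
qed

lemma reachable_from_metric:
  assumes "u \<in> pverts G" "v \<in> pverts G"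
  shows "u \<rightarrow>\<^sup>*\<^bsub>with_proj G\<^esub> v"
  using assms(1)
proof (induction "D u v" arbitrary: u rule: less_induct)
  case less
  show ?case
  proof (cases "u = v")
    case False
    then obtain w where "(u, w) \<in> parcs G" "D u v = Suc (D w v)"
      using closer_neighbour less.prems assms(2) by blast
    then show ?thesis
      using less.hyps[of w] arc_verts adj_reachable_trans[of u w v] by auto
  qed (use assms in auto)
qed

lemma tree_dist_eq:
  assumes "u \<in> pverts G" "v \<in> pverts G"
  shows "tree_dist G u v = D u v"
proof -
  obtain p where p: "apath u p v"
    using reachable_from_metric[OF assms] reachable_apath by blast
  then have "(THE p. apath u p v) = p"
    using apath_unique by blast
  then show ?thesis
    using length_apath_eq_dist[OF p] by (simp add: tree_dist_def)
qed

text \<open>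
  A cycle of length at least 3 minus its first arc would be a path of length at least 2 between
  adjacent nodes, but the length of a path is the distance of its ends.
\<close>

lemma undirected_tree_from_metric:
  assumes "pverts G \<noteq> {}"
  shows "undirected_tree G"
proof -
  have "strongly_connected (with_proj G)"
    using assms reachable_from_metric by (auto simp: strongly_connected_def)
  then have con: "connected (with_proj G)"
    using reachable_mk_symmetricI by (auto simp: connected_def strongly_connected_def)
  have "\<not> (cycle p \<and> 3 \<le> length p)" for p
  proof
    assume *: "cycle p \<and> 3 \<le> length p"
    then obtain u where u: "awalk u p u" "distinct (tl (pawalk_verts u p))"
      by (auto simp: cycle_def)
    obtain e q where p: "p = e # q"
      using * by (cases p) auto
    obtain w where e: "e = (u, w)"
      using u by (cases e) (auto simp: awalk_Cons_iff p)
    have "apath w q u"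
      using u by (simp add: apath_def awalk_Cons_iff p e)
    then have "length q = D w u"
      by (rule length_apath_eq_dist)
    also have "\<dots> = 1"
      using u arc_dist[of w u] arc_sym[of u w] by (simp add: awalk_Cons_iff p e)
    finally show False
      using * p by simp
  qed
  then show ?thesis
    using con pair_graph by (auto simp: undirected_tree_def)
qed

end

text \<open>
  A walk that avoids the edge \<open>ab\<close> contains a path of length at least 2 from \<open>a\<close> to \<open>b\<close>, which the arc
  from \<open>b\<close> to \<open>a\<close> closes to a cycle.
\<close>

lemma (in pair_graph) arc_is_bridge:
  assumes acyclic: "\<not> (\<exists>p. cycle p \<and> 3 \<le> length p)" and ab: "(a, b) \<in> parcs G"
  shows "(a, b) \<notin> (parcs G - {(a, b), (b, a)})\<^sup>*"
proof
  let ?H = "\<lparr>pverts = pverts G, parcs = parcs G - {(a, b), (b, a)}\<rparr>"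
  interpret H: pair_wf_digraph ?H
    by unfold_locales (auto dest: in_arcsD1 in_arcsD2)
  assume walk: "(a, b) \<in> (parcs G - {(a, b), (b, a)})\<^sup>*"
  have "a \<rightarrow>\<^sup>*\<^bsub>with_proj ?H\<^esub> c" if "(a, c) \<in> (parcs ?H)\<^sup>*" for c
    using that
  proof (induction rule: rtrancl_induct)
    case base
    show ?case
      using in_arcsD1[OF ab] by (intro H.reachable_refl) simp
  next
    case (step y z)
    then show ?case
      using H.reachable_adj_trans[of a y z] by simp
  qed
  from this[of b] walk obtain p where p: "H.apath a p b"
    unfolding H.reachable_apath by auto
  have aw: "a \<in> pverts G" "set p \<subseteq> parcs G - {(a, b), (b, a)}" "pcas a p b"
      "distinct (pawalk_verts a p)"
    using p by (auto simp: H.apath_def H.awalk_def)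
  have "awalk b ((b, a) # p) b" "distinct (tl (pawalk_verts b ((b, a) # p)))"
    using aw arcs_symmetric[OF ab] in_arcsD2[OF ab] by (auto simp: awalk_def)
  then have "cycle ((b, a) # p)"
    by (auto simp: cycle_def)
  moreover have "3 \<le> length ((b, a) # p)"
  proof (cases p rule: remdups_adj.cases)
    case 1
    then show ?thesis
      using aw no_loops'[OF ab] by simp
  next
    case (2 e)
    then show ?thesis
      using aw by (cases e) auto
  qed auto
  ultimately show False
    using acyclic by blast
qed

text \<open>
  The length of a shortest walk; it is only meaningful for pairs that are connected by a walk.
\<close>

definition rel_dist :: "'a rel \<Rightarrow> 'a \<Rightarrow> 'a \<Rightarrow> nat" where
  "rel_dist E u v = (LEAST n. (u, v) \<in> E ^^ n)"

lemma rel_dist_relpow: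
  assumes "(u, v) \<in> E\<^sup>*"
  shows "(u, v) \<in> E ^^ rel_dist E u v"
  unfolding rel_dist_def using assms by (meson LeastI rtrancl_imp_relpow)

lemma rel_dist_le: "(u, v) \<in> E ^^ n \<Longrightarrow> rel_dist E u v \<le> n"
  unfolding rel_dist_def by (rule Least_le)

lemma rel_dist_arc_le:
  assumes "(u, w) \<in> E" "(w, v) \<in> E\<^sup>*"
  shows "rel_dist E u v \<le> Suc (rel_dist E w v)"
  using rel_dist_le relpow_Suc_I2[OF assms(1) rel_dist_relpow[OF assms(2)]] .

lemma rel_dist_closer:
  assumes "(u, v) \<in> E\<^sup>*" "u \<noteq> v"
  obtains w where "(u, w) \<in> E" "(w, v) \<in> E\<^sup>*" "rel_dist E u v = Suc (rel_dist E w v)"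
proof -
  obtain n where n: "rel_dist E u v = Suc n"
    using rel_dist_relpow[OF assms(1)] assms(2) by (cases "rel_dist E u v") auto
  then have "(u, v) \<in> E ^^ Suc n"
    using rel_dist_relpow[OF assms(1)] by simp
  then obtain w where w: "(u, w) \<in> E" "(w, v) \<in> E ^^ n"
    by (elim relpow_Suc_E2)
  then have "(w, v) \<in> E\<^sup>*" "rel_dist E w v \<le> n"
    using relpow_imp_rtrancl rel_dist_le by auto
  then show ?thesis
    using that[of w] w rel_dist_arc_le[of u w E v] n by simp
qed

text \<open>
  A shortest walk to \<open>v\<close> descends towards \<open>v\<close>, so it meets no node, except possibly \<open>u\<close>, that is at
  least as far from \<open>v\<close> as \<open>u\<close> is. This is how walks are shown to avoid a given edge.
\<close>

lemma descending_walk: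
  assumes "(u, v) \<in> E\<^sup>*" "rel_dist E u v \<le> m"
  shows "(u, v) \<in> {(a, b) \<in> E. rel_dist E b v < rel_dist E a v \<and> rel_dist E a v \<le> m}\<^sup>*"
  using assms
proof (induction "rel_dist E u v" arbitrary: u rule: less_induct)
  case less
  show ?case
  proof (cases "u = v")
    case False
    then obtain w where w: "(u, w) \<in> E" "(w, v) \<in> E\<^sup>*" "rel_dist E u v = Suc (rel_dist E w v)"
      using rel_dist_closer less.prems by metis
    then show ?thesis
      using less.hyps[of w] less.prems by (intro converse_rtrancl_into_rtrancl[of u w]) auto
  qed simp
qed

lemma rel_dist_sym:
  assumes "sym E"
  shows "rel_dist E u v = rel_dist E v u"
proof -
  have "(v, u) \<in> E ^^ n" if "(u, v) \<in> E ^^ n" for u v n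
    using that
  proof (induction n arbitrary: v)
    case (Suc n)
    then obtain w where "(u, w) \<in> E ^^ n" "(w, v) \<in> E"
      by auto
    then show ?case
      using Suc.IH assms relpow_Suc_I2[of v w E u n] by (auto dest: symD)
  qed simp
  then show ?thesis
    unfolding rel_dist_def by metis
qed

text \<open>
  If a neighbour \<open>k'\<close> of \<open>i\<close> other than the closer neighbour \<open>k\<close> were not farther from \<open>j\<close> than \<open>i\<close>, then
  one could descend from \<open>k'\<close> to \<open>j\<close> and climb back over \<open>k\<close> to \<open>i\<close> without using the edge \<open>ik'\<close>,
  which contradicts that every edge is a bridge.
\<close>

lemma tree_metric_rel_dist:
  assumes "undirected_tree G"
  shows "tree_metric (pverts G) (parcs G) (rel_dist (parcs G))"
proof -
  interpret pair_graph G
    using assms by (simp add: undirected_tree_def)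
  define E where "E = parcs G"
  define D where "D = rel_dist E"
  have acyc: "\<not> (\<exists>p. cycle p \<and> 3 \<le> length p)" and con: "connected (with_proj G)"
    using assms by (auto simp: undirected_tree_def)
  have bridge: "(a, b) \<notin> (E - {(a, b), (b, a)})\<^sup>*" if "(a, b) \<in> E" for a b
    using arc_is_bridge[OF acyc] that unfolding E_def .
  have symE: "(b, a) \<in> E" if "(a, b) \<in> E" for a b
    using that arcs_symmetric by (simp add: E_def)
  have reach: "(u, v) \<in> E\<^sup>*" if "u \<in> pverts G" "v \<in> pverts G" for u v
  proof -
    have "u \<rightarrow>\<^sup>*\<^bsub>with_proj G\<^esub> v"
      using con that reachable_mk_symmetric_eq symmetric_conv sym_arcs
      by (auto simp: connected_def strongly_connected_def)
    then show ?thesis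
      using reachable_rtranclI by (fastforce simp: E_def)
  qed
  have closer: "\<exists>k. (i, k) \<in> E \<and> D i j = Suc (D k j)
      \<and> (\<forall>k'. (i, k') \<in> E \<and> k' \<noteq> k \<longrightarrow> D k' j = Suc (D i j))"
    if i: "i \<in> pverts G" and j: "j \<in> pverts G" and ij: "i \<noteq> j" for i j
  proof -
    obtain k where k: "(i, k) \<in> E" "D i j = Suc (D k j)"
      using rel_dist_closer[OF reach[OF i j] ij] unfolding D_def by metis
    define desc where "desc m = {(a, b) \<in> E. D b j < D a j \<and> D a j \<le> m}" for m
    have desc: "(u, j) \<in> (desc m)\<^sup>*" if "u \<in> pverts G" "D u j \<le> m" for u m
      using descending_walk[OF reach[OF that(1) j]] that(2) by (simp add: desc_def D_def)
    have asc: "(j, u) \<in> ((desc m)\<inverse>)\<^sup>*" if "u \<in> pverts G" "D u j \<le> m" for u m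
      using desc[OF that] by (simp add: rtrancl_converseI)
    have "D k' j = Suc (D i j)" if k': "(i, k') \<in> E" "k' \<noteq> k" for k'
    proof (rule ccontr)
      assume neq: "D k' j \<noteq> Suc (D i j)"
      have k'V: "k' \<in> pverts G" and kV: "k \<in> pverts G"
        using in_arcsD2 k k' by (auto simp: E_def)
      have "D k' j \<le> Suc (D i j)"
        using rel_dist_arc_le[OF symE[OF k'(1)] reach[OF i j]] by (simp add: D_def)
      with neq have le: "D k' j \<le> D i j"
        by simp
      let ?F = "E - {(i, k'), (k', i)}"
      \<comment> \<open>Descend from \<open>k'\<close> to \<open>j\<close>, and climb back to \<open>i\<close> through \<open>k\<close>.\<close>
      have "desc (D k' j) \<subseteq> ?F"
        using le k' by (auto simp: desc_def)
      then have "(k', j) \<in> ?F\<^sup>*"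
        using desc[OF k'V order_refl] rtrancl_mono by blast
      moreover have "(desc (D k j))\<inverse> \<subseteq> ?F"
        using k symE by (auto simp: desc_def)
      then have "(j, k) \<in> ?F\<^sup>*"
        using asc[OF kV order_refl] rtrancl_mono by blast
      moreover have "(k, i) \<in> ?F"
        using k k' symE no_loops' by (auto simp: E_def)
      ultimately have "(k', i) \<in> ?F\<^sup>*"
        by (meson rtrancl.rtrancl_into_rtrancl rtrancl_trans)
      then show False
        using bridge[OF symE[OF k'(1)]] by (simp add: insert_commute)
    qed
    then show ?thesis
      using k by blast
  qed
  have "tree_metric (pverts G) E D"
  proof
    show "E \<subseteq> pverts G \<times> pverts G"
      by (auto simp: E_def dest: in_arcsD1 in_arcsD2)
    show "(i, i) \<notin> E" for i
      using no_loops' by (auto simp: E_def)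
    show "D i i = 0" for i
      using rel_dist_le[of i i 0 E] by (simp add: D_def)
    show "D i j = D j i" for i j
      unfolding D_def using symE by (intro rel_dist_sym symI)
  qed (use symE closer in auto)
  then show ?thesis
    by (simp add: D_def E_def)
qed

lemma undirected_tree_metric:
  assumes "undirected_tree G"
  shows "graph_tree_metric G (tree_dist G)"
proof -
  interpret pair_graph G
    using assms by (simp add: undirected_tree_def)
  interpret D: graph_tree_metric G "rel_dist (parcs G)"
    using tree_metric_rel_dist[OF assms] by (simp add: graph_tree_metric_def pair_graph)
  show ?thesis
  proof
    fix i j
    assume "i \<in> pverts G" "j \<in> pverts G" "i \<noteq> j"
    then show "\<exists>k. (i, k) \<in> parcs G \<and> tree_dist G i j = Suc (tree_dist G k j)
        \<and> (\<forall>k'. (i, k') \<in> parcs G \<and> k' \<noteq> k \<longrightarrow> tree_dist G k' j = Suc (tree_dist G i j))"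
      using D.ex_unique_closer[of i j] by (metis D.arc_verts(2) D.tree_dist_eq)
  qed (use D.arcs_in_verts D.arc_irrefl D.dist_self D.dist_sym D.arc_sym in
      \<open>auto simp: D.tree_dist_eq\<close>)
qed

section \<open>Contracting an inner edge\<close>

text \<open>
  The edge \<open>xy\<close> splits the nodes into the side of \<open>x\<close>, called \<open>near\<close>, and the side of \<open>y\<close>. Since \<open>y\<close> is
  the node that becomes a leaf, it is kept apart: \<open>far\<close> is its side without \<open>y\<close> itself.
\<close>

locale tree_metric_edge = tree_metric +
  fixes x y
  assumes xy: "(x, y) \<in> E"
begin

lemma x_in: "x \<in> V" and y_in: "y \<in> V"
  using arc_verts[OF xy] .

definition near where "near = {v \<in> V. D x v < D y v}"
definition far where "far = {v \<in> V. D y v < D x v} - {y}"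

lemma dist_xy: "D x y = 1" "D y x = 1"
  using arc_dist[OF xy] arc_dist[OF arc_sym[OF xy]] by auto

lemma x_neq_y: "x \<noteq> y"
  using xy arc_irrefl by auto

lemma near_dist: "v \<in> near \<Longrightarrow> D y v = Suc (D x v)"
  using arc_dist_cases[OF xy, of v] by (auto simp: near_def)

lemma far_dist: "v \<in> far \<Longrightarrow> D x v = Suc (D y v)"
  using arc_dist_cases[OF xy, of v] by (auto simp: far_def)

lemma near_in: "v \<in> near \<Longrightarrow> v \<in> V" and far_in: "v \<in> far \<Longrightarrow> v \<in> V"
  by (auto simp: near_def far_def)

lemma x_near: "x \<in> near"
  using dist_self x_in dist_xy by (simp add: near_def)

lemma y_not_near: "y \<notin> near"
  using dist_self y_in dist_xy by (simp add: near_def)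

lemma y_not_far: "y \<notin> far"
  by (simp add: far_def)

lemma near_not_far: "v \<in> near \<Longrightarrow> v \<notin> far"
  by (auto simp: near_def far_def)

lemma partition: "v \<in> V \<Longrightarrow> v \<in> near \<or> v \<in> far \<or> v = y"
  using arc_dist_cases[OF xy, of v] by (auto simp: near_def far_def)

text \<open>
  Comparing the distances of \<open>a\<close> and \<open>b\<close> to \<open>x\<close> and to \<open>y\<close> gives \<open>D b y = D a x\<close>. If \<open>b\<close> were not \<open>y\<close>, its
  neighbour towards \<open>y\<close> would be different from its neighbour \<open>a\<close> towards \<open>x\<close>; it would therefore be
  farther from \<open>x\<close> than \<open>b\<close>, although it is closer to \<open>y\<close>, and \<open>x\<close> and \<open>y\<close> are adjacent.
\<close>

lemma crossing_arc:
  assumes "(a, b) \<in> E" "a \<in> near" "b \<notin> near"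
  shows "a = x \<and> b = y"
proof -
  have V: "a \<in> V" "b \<in> V"
    using arc_verts assms by auto
  have "b \<in> far \<or> b = y"
    using partition V assms by auto
  then have "D x b = Suc (D y b)"
    using far_dist dist_self y_in dist_xy by auto
  then have b: "D b x = Suc (D b y)"
    using dist_sym[OF V(2) x_in] dist_sym[OF V(2) y_in] by simp
  have "D y a = Suc (D x a)"
    using near_dist assms by auto
  then have a: "D a y = Suc (D a x)"
    using dist_sym[OF V(1) x_in] dist_sym[OF V(1) y_in] by simp
  have "D b x = Suc (D a x) \<or> D a x = Suc (D b x)" "D b y = Suc (D a y) \<or> D a y = Suc (D b y)"
    using arc_dist_cases[OF assms(1)] x_in y_in by auto
  then have eq: "D b y = D a x"
    using a b by linarith
  show ?thesis
  proof (cases "b = y")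
    case True
    then have "D a x = 0"
      using eq dist_self y_in by simp
    then show ?thesis
      using True dist_eq_0_iff V x_in by auto
  next
    case False
    then obtain c where c: "(b, c) \<in> E" "D b y = Suc (D c y)"
      using closer_neighbour V y_in by metis
    have cV: "c \<in> V"
      using arc_verts c by auto
    have "c \<noteq> a"
      using c(2) eq a by auto
    then have "D c x = Suc (D b x)"
      using other_neighbour_farther[of b a c x] arc_sym[OF assms(1)] c(1) x_in b eq by auto
    then have "D x c = Suc (Suc (Suc (D y c)))"
      using b c dist_sym[OF cV x_in] dist_sym[OF cV y_in] by simp
    then show ?thesis
      using arc_dist_cases[OF xy cV] by auto
  qed
qed

definition contracted_arcs where
  "contracted_arcs = {(u, v) \<in> E. (u = y \<longrightarrow> v = x) \<and> (v = y \<longrightarrow> u = x)}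
     \<union> {(x, z) |z. (y, z) \<in> E \<and> z \<noteq> x} \<union> {(z, x) |z. (y, z) \<in> E \<and> z \<noteq> x}"

text \<open>
  The distances after the contraction: \<open>y\<close> hangs on \<open>x\<close>, so its distance to a node of \<open>far\<close> is
  the former distance of \<open>x\<close>, and other pairs on different sides lose the edge \<open>xy\<close>.
\<close>

definition contracted_dist where
  "contracted_dist u v =
    (if u = v then 0
     else if u = y then (if v \<in> near then D y v else D x v)
     else if v = y then (if u \<in> near then D u y else D u x)
     else if u \<in> near \<longleftrightarrow> v \<in> near then D u v else D u v - 1)"

lemma contracted_dist_near_near:
  "u \<in> near \<Longrightarrow> v \<in> near \<Longrightarrow> contracted_dist u v = D u v"
  using y_not_near dist_self near_in by (auto simp: contracted_dist_def)

lemma contracted_dist_far_far: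
  "u \<in> far \<Longrightarrow> v \<in> far \<Longrightarrow> contracted_dist u v = D u v"
  using y_not_far near_not_far dist_self far_in by (auto simp: contracted_dist_def)

lemma contracted_dist_near_far:
  "u \<in> near \<Longrightarrow> v \<in> far \<Longrightarrow> D u v = Suc (contracted_dist u v)"
  "u \<in> near \<Longrightarrow> v \<in> far \<Longrightarrow> D v u = Suc (contracted_dist v u)"
  using dist_eq_0_iff[of u v] dist_eq_0_iff[of v u] y_not_near y_not_far near_not_far near_in far_in
  by (auto simp: contracted_dist_def)

lemma contracted_dist_y_near:
  "u \<in> near \<Longrightarrow> contracted_dist u y = D u y"
  "u \<in> near \<Longrightarrow> contracted_dist y u = D y u"
  using y_not_near by (auto simp: contracted_dist_def)

lemma contracted_dist_y_far:
  "u \<in> far \<Longrightarrow> contracted_dist u y = Suc (D u y)"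
  "u \<in> far \<Longrightarrow> contracted_dist y u = Suc (D y u)"
  using y_not_far far_dist near_not_far dist_sym x_in y_in far_in
  by (auto simp: contracted_dist_def)

lemma contracted_dist_self: "contracted_dist u u = 0"
  by (simp add: contracted_dist_def)

lemma y_neighbour_far: "(y, k) \<in> E \<Longrightarrow> k \<noteq> x \<Longrightarrow> k \<in> far"
  using crossing_arc[of k y] arc_sym[of y k] partition[of k] arc_verts[of y k] arc_irrefl[of y]
    y_not_near by auto

lemma x_neighbour_near: "(x, k) \<in> E \<Longrightarrow> k \<noteq> y \<Longrightarrow> k \<in> near"
  using crossing_arc[of x k] x_near by auto

lemma near_neighbour_near: "(i, k) \<in> E \<Longrightarrow> i \<in> near \<Longrightarrow> i \<noteq> x \<Longrightarrow> k \<in> near"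
  using crossing_arc[of i k] by auto

lemma far_neighbour_far: "(i, k) \<in> E \<Longrightarrow> i \<in> far \<Longrightarrow> k \<noteq> y \<Longrightarrow> k \<in> far"
  using crossing_arc[of k i] arc_sym[of i k] partition[of k] arc_verts[of i k] near_not_far[of i]
    y_not_far by auto

lemma contracted_arcs_y: "(y, k) \<in> contracted_arcs \<longleftrightarrow> k = x"
  using xy arc_sym arc_irrefl x_neq_y by (auto simp: contracted_arcs_def)

lemma contracted_arcs_x:
  "(x, k) \<in> contracted_arcs \<longleftrightarrow> (x, k) \<in> E \<or> (y, k) \<in> E \<and> k \<noteq> x"
  using xy arc_sym arc_irrefl x_neq_y by (auto simp: contracted_arcs_def)

lemma contracted_arcs_near:
  assumes "i \<in> near" "i \<noteq> x"
  shows "(i, k) \<in> contracted_arcs \<longleftrightarrow> (i, k) \<in> E"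
  using assms y_neighbour_far arc_sym near_not_far y_not_near near_neighbour_near
  by (auto simp: contracted_arcs_def)

lemma contracted_arcs_far:
  assumes "i \<in> far"
  shows "(i, k) \<in> contracted_arcs \<longleftrightarrow> (\<exists>l. (i, l) \<in> E \<and> k = (if l = y then x else l))"
  using assms near_not_far x_near y_not_far arc_sym
  by (fastforce simp: contracted_arcs_def)

text \<open>
  Wherever the neighbourhood of \<open>i\<close> is unchanged up to renaming \<open>y\<close> to \<open>x\<close>, all distances to \<open>j\<close> involved
  shift by the same constant, and the property is inherited. The new leaf \<open>y\<close> has one neighbour
  only. The node \<open>x\<close> inherits the neighbours of \<open>y\<close>: its closer neighbour is the former one of \<open>x\<close> or of
  \<open>y\<close>, depending on the side of \<open>j\<close>, and the neighbours on the opposite side are farther.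
\<close>

lemma contracted_closer:
  assumes i: "i \<in> V" and j: "j \<in> V" and ij: "i \<noteq> j"
  shows "\<exists>k. (i, k) \<in> contracted_arcs \<and> contracted_dist i j = Suc (contracted_dist k j) \<and>
    (\<forall>k'. (i, k') \<in> contracted_arcs \<and> k' \<noteq> k \<longrightarrow> contracted_dist k' j = Suc (contracted_dist i j))"
proof -
  consider (y) "i = y" | (near) "i \<in> near" "i \<noteq> x" | (far) "i \<in> far" | (x) "i = x"
    using partition i by blast
  then show ?thesis
  proof cases
    case y
    have "j \<in> near \<or> j \<in> far"
      using partition[OF j] ij y by auto
    then have "contracted_dist y j = Suc (contracted_dist x j)"
    proof
      assume "j \<in> near"
      then show ?thesis
        using near_dist x_near by (simp add: contracted_dist_near_near contracted_dist_y_near)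
    next
      assume "j \<in> far"
      then show ?thesis
        using far_dist[of j] contracted_dist_near_far(1)[OF x_near] contracted_dist_y_far(2)[of j]
        by simp
    qed
    then show ?thesis
      using y contracted_arcs_y by auto
  next
    case near
    obtain k where k: "(i, k) \<in> E" "D i j = Suc (D k j)"
        "\<And>k'. (i, k') \<in> E \<Longrightarrow> k' \<noteq> k \<Longrightarrow> D k' j = Suc (D i j)"
      using ex_unique_closer[OF i j ij] by metis
    define c :: nat where "c = (if j \<in> far then 1 else 0)"
    have c: "D l j = contracted_dist l j + c" if "l \<in> near" for l
      using partition[OF j] contracted_dist_near_near[OF that, of j]
        contracted_dist_y_near(1)[OF that] contracted_dist_near_far(1)[OF that, of j]
        near_not_far[of j] y_not_far by (auto simp: c_def)
    have nbr: "l \<in> near" if "(i, l) \<in> E" for l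
      using near_neighbour_near[OF that] near by simp
    show ?thesis
      unfolding contracted_arcs_near[OF near]
      using k(1,2) c[OF nbr[OF k(1)]] c[OF near(1)] c[OF nbr] k(3)
      by (intro exI[of _ k]) fastforce
  next
    case far
    obtain k where k: "(i, k) \<in> E" "D i j = Suc (D k j)"
        "\<And>k'. (i, k') \<in> E \<Longrightarrow> k' \<noteq> k \<Longrightarrow> D k' j = Suc (D i j)"
      using ex_unique_closer[OF i j ij] by metis
    define f where "f l = (if l = y then x else l)" for l
    have shift: "contracted_dist (f l) j + D i j = D l j + contracted_dist i j" if "(i, l) \<in> E" for l
    proof -
      have l: "l \<in> far \<or> l = y"
        using far_neighbour_far far that by blast
      consider "j \<in> near" | "j \<in> far" | "j = y"
        using partition j by blast
      then show ?thesis
      proof cases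
        case 1
        then show ?thesis
          using l far x_near y_not_far contracted_dist_near_far(2)[of j i]
            contracted_dist_near_far(2)[of j l] contracted_dist_near_near[of x j] near_dist[of j]
          by (auto simp: f_def)
      next
        case 2
        then show ?thesis
          using l far x_near y_not_far contracted_dist_far_far[of i j]
            contracted_dist_far_far[of l j] contracted_dist_near_far(1)[of x j] far_dist[of j]
          by (auto simp: f_def)
      next
        case 3
        then show ?thesis
          using l far x_near y_not_far contracted_dist_y_far(1)[of i] contracted_dist_y_far(1)[of l]
            contracted_dist_y_near(1)[of x] dist_xy dist_self[OF y_in]
          by (auto simp: f_def)
      qed
    qed
    have arcs: "(i, m) \<in> contracted_arcs \<longleftrightarrow> (\<exists>l. (i, l) \<in> E \<and> m = f l)" for m
      using contracted_arcs_far[OF far] by (simp add: f_def)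
    show ?thesis
    proof (intro exI[of _ "f k"] conjI allI impI)
      show "(i, f k) \<in> contracted_arcs"
        using arcs k by blast
      show "contracted_dist i j = Suc (contracted_dist (f k) j)"
        using shift[OF k(1)] k(2) by simp
    next
      fix m assume "(i, m) \<in> contracted_arcs \<and> m \<noteq> f k"
      then obtain l where l: "(i, l) \<in> E" "m = f l" "l \<noteq> k"
        using arcs by blast
      then show "contracted_dist m j = Suc (contracted_dist i j)"
        using shift[OF l(1)] k(3)[of l] by simp
    qed
  next
    case x
    consider (near) "j \<in> near" | (far) "j \<in> far" | (y) "j = y"
      using partition j by blast
    then show ?thesis
    proof cases
      case near
      obtain k where k: "(x, k) \<in> E" "D x j = Suc (D k j)"
          "\<And>k'. (x, k') \<in> E \<Longrightarrow> k' \<noteq> k \<Longrightarrow> D k' j = Suc (D x j)"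
        using ex_unique_closer[OF i j ij] x by metis
      have "k \<noteq> y"
        using k near_dist near by auto
      then have knear: "k \<in> near"
        using x_neighbour_near k by auto
      show ?thesis
      proof (intro exI[of _ k] conjI allI impI)
        show "(i, k) \<in> contracted_arcs"
          using k x contracted_arcs_x by simp
        show "contracted_dist i j = Suc (contracted_dist k j)"
          using k x x_near near knear by (simp add: contracted_dist_near_near)
      next
        fix l assume l: "(i, l) \<in> contracted_arcs \<and> l \<noteq> k"
        consider "(x, l) \<in> E" "l \<noteq> y" | "l = y" | "(y, l) \<in> E" "l \<noteq> x"
          using l x contracted_arcs_x by blast
        then show "contracted_dist l j = Suc (contracted_dist i j)"
        proof cases
          case 1
          then show ?thesis
            using l x x_neighbour_near k(3)[of l] near x_near by (simp add: contracted_dist_near_near)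
        next
          case 2
          then show ?thesis
            using x near x_near near_dist by (simp add: contracted_dist_near_near contracted_dist_y_near)
        next
          case 3
          then have "l \<in> far"
            using y_neighbour_far by blast
          moreover have "D l j = Suc (D y j)"
            using other_neighbour_farther[of y x l j] 3 arc_sym[OF xy] j near_dist[OF near] by auto
          ultimately show ?thesis
            using x near x_near near_dist[OF near] contracted_dist_near_far(2)[OF near, of l]
            by (simp add: contracted_dist_near_near)
        qed
      qed
    next
      case far
      then have "y \<noteq> j"
        using y_not_far by auto
      then obtain k where k: "(y, k) \<in> E" "D y j = Suc (D k j)"
          "\<And>k'. (y, k') \<in> E \<Longrightarrow> k' \<noteq> k \<Longrightarrow> D k' j = Suc (D y j)"
        using ex_unique_closer[OF y_in j] by metis
      have "k \<noteq> x"
        using k far_dist far by auto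
      then have kfar: "k \<in> far"
        using y_neighbour_far k by auto
      have xj: "contracted_dist x j = D y j"
        using contracted_dist_near_far(1)[OF x_near far] far_dist[OF far] by simp
      show ?thesis
      proof (intro exI[of _ k] conjI allI impI)
        show "(i, k) \<in> contracted_arcs"
          using k x \<open>k \<noteq> x\<close> contracted_arcs_x by simp
        show "contracted_dist i j = Suc (contracted_dist k j)"
          using k x kfar far xj by (simp add: contracted_dist_far_far)
      next
        fix l assume l: "(i, l) \<in> contracted_arcs \<and> l \<noteq> k"
        consider "(x, l) \<in> E" "l \<noteq> y" | "l = y" | "(y, l) \<in> E" "l \<noteq> x"
          using l x contracted_arcs_x by blast
        then show "contracted_dist l j = Suc (contracted_dist i j)"
        proof cases
          case 1
          then have "l \<in> near"
            using x_neighbour_near by blast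
          moreover have "D l j = Suc (D x j)"
            using other_neighbour_farther[of x y l j] 1 xy j far_dist[OF far] by auto
          ultimately show ?thesis
            using x xj far_dist[OF far] contracted_dist_near_far(1)[of l, OF _ far] by simp
        next
          case 2
          then show ?thesis
            using x xj far by (simp add: contracted_dist_y_far)
        next
          case 3
          then show ?thesis
            using l x xj y_neighbour_far k(3)[of l] far by (simp add: contracted_dist_far_far)
        qed
      qed
    next
      case y
      have xy': "contracted_dist x y = 1"
        using contracted_dist_y_near(1)[OF x_near] dist_xy by simp
      show ?thesis
      proof (intro exI[of _ y] conjI allI impI)
        show "(i, y) \<in> contracted_arcs"
          using x xy contracted_arcs_x by simp
        show "contracted_dist i j = Suc (contracted_dist y j)"
          using x y xy' contracted_dist_self by simp
      next
        fix l assume l: "(i, l) \<in> contracted_arcs \<and> l \<noteq> y"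
        consider "(x, l) \<in> E" "l \<noteq> y" | "(y, l) \<in> E" "l \<noteq> x"
          using l x contracted_arcs_x by blast
        then show "contracted_dist l j = Suc (contracted_dist i j)"
        proof cases
          case 1
          then show ?thesis
            using other_neighbour_farther[of x y l y] xy y_in dist_self dist_xy x_neighbour_near
              x y xy' by (simp add: contracted_dist_y_near)
        next
          case 2
          then show ?thesis
            using y_neighbour_far arc_dist[of l y] arc_sym x y xy' by (simp add: contracted_dist_y_far)
        qed
      qed
    qed
  qed
qed

lemma tree_metric_contracted: "tree_metric V contracted_arcs contracted_dist"
proof
  show "contracted_arcs \<subseteq> V \<times> V"
    using arc_verts x_in by (auto simp: contracted_arcs_def)
  show "(k, i) \<in> contracted_arcs" if "(i, k) \<in> contracted_arcs" for i k
    using that arc_sym by (auto simp: contracted_arcs_def)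
  show "(i, i) \<notin> contracted_arcs" for i
    using arc_irrefl by (auto simp: contracted_arcs_def)
  show "contracted_dist i i = 0" for i
    by (rule contracted_dist_self)
  show "contracted_dist i j = contracted_dist j i" if "i \<in> V" "j \<in> V" for i j
    using dist_sym that x_in y_in by (auto simp: contracted_dist_def)
qed (rule contracted_closer)

text \<open>
  Pairs between \<open>near\<close> and \<open>far\<close> lose one, pairs of \<open>y\<close> with \<open>far\<close> gain one. Writing the changes as
  products of indicators makes their sum over all pairs a matter of cardinalities.
\<close>

lemma contracted_dist_balance:
  assumes "u \<in> V" "v \<in> V"
  shows "contracted_dist u v
      + of_bool (u \<in> near) * of_bool (v \<in> far) + of_bool (u \<in> far) * of_bool (v \<in> near)
    = D u v + of_bool (u = y) * of_bool (v \<in> far) + of_bool (u \<in> far) * of_bool (v = y)"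
  using partition[OF assms(1)] partition[OF assms(2)]
  by (elim disjE)
    (use near_not_far y_not_near y_not_far dist_self[OF y_in] in
      \<open>auto simp: contracted_dist_near_near contracted_dist_far_far contracted_dist_near_far
        contracted_dist_y_near contracted_dist_y_far contracted_dist_self\<close>)

text \<open>
  The only distances that grow, those between \<open>y\<close> and \<open>far\<close>, become former distances to \<open>x\<close>; so the
  diameter cannot grow.
\<close>

lemma contracted_dist_bounds:
  assumes "u \<in> V" "v \<in> V"
  shows "D u v \<le> Suc (contracted_dist u v)"
    and "contracted_dist u v \<le> D u v \<or> (\<exists>a\<in>V. \<exists>b\<in>V. contracted_dist u v = D a b)"
proof -
  have "of_bool (u \<in> near) * of_bool (v \<in> far) + of_bool (u \<in> far) * of_bool (v \<in> near)
      \<le> (1 :: nat)"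
    using near_not_far[of u] by (auto simp: of_bool_def)
  then show "D u v \<le> Suc (contracted_dist u v)"
    using contracted_dist_balance[OF assms] by linarith
  show "contracted_dist u v \<le> D u v \<or> (\<exists>a\<in>V. \<exists>b\<in>V. contracted_dist u v = D a b)"
    using assms x_in dist_self[OF x_in] by (auto simp: contracted_dist_def)
qed

lemma sum_contracted_dist:
  assumes "finite V"
  shows "(\<Sum>u\<in>V. \<Sum>v\<in>V. contracted_dist u v) + 2 * card near * card far
    = (\<Sum>u\<in>V. \<Sum>v\<in>V. D u v) + 2 * card far"
proof -
  have prod: "(\<Sum>u\<in>V. \<Sum>v\<in>V. of_bool (P u) * of_bool (Q v)) = card {u \<in> V. P u} * card {v \<in> V. Q v}"
    for P Q
    using assms by (simp add: sum_distrib_left[symmetric] sum_distrib_right[symmetric] Int_def)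
  have near: "{u \<in> V. u \<in> near} = near" and far: "{u \<in> V. u \<in> far} = far"
    and y: "{u \<in> V. u = y} = {y}"
    using near_in far_in y_in by auto
  have "(\<Sum>u\<in>V. \<Sum>v\<in>V. contracted_dist u v + of_bool (u \<in> near) * of_bool (v \<in> far)
      + of_bool (u \<in> far) * of_bool (v \<in> near))
    = (\<Sum>u\<in>V. \<Sum>v\<in>V. D u v + of_bool (u = y) * of_bool (v \<in> far)
      + of_bool (u \<in> far) * of_bool (v = y))"
    by (intro sum.cong refl contracted_dist_balance)
  then show ?thesis
    by (simp only: sum.distrib prod near far y) (simp add: algebra_simps)
qed

text \<open>
  The sum changes by \<open>2 |far| (1 - |near|)\<close>, and \<open>near\<close> contains \<open>x\<close> and \<open>u\<close>.
\<close>

lemma sum_contracted_dist_less: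
  assumes "finite V" "u \<in> near" "u \<noteq> x" "far \<noteq> {}"
  shows "(\<Sum>u\<in>V. \<Sum>v\<in>V. contracted_dist u v) < (\<Sum>u\<in>V. \<Sum>v\<in>V. D u v)"
proof -
  have fin: "finite near" "finite far"
    using assms(1) by (auto simp: near_def far_def)
  have "card {x, u} \<le> card near"
    using fin assms x_near by (intro card_mono) auto
  then have "2 \<le> card near"
    using assms by simp
  moreover have "0 < card far"
    using assms fin by (simp add: card_gt_0_iff)
  ultimately have "2 * card far < 2 * card near * card far"
    by simp
  then show ?thesis
    using sum_contracted_dist[OF assms(1)] by linarith
qed

end

section \<open>The Laplacian of a tree and its distances\<close>

locale numbered_tree = graph_tree_metric T D for T :: "nat pair_pre_digraph" and D +
  fixes N :: nat
  assumes verts: "pverts T = {0..<N}" and N_pos: "0 < N"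
begin

definition adj :: "nat \<Rightarrow> nat \<Rightarrow> real" where
  "adj i j = of_bool ((i, j) \<in> parcs T)"

definition deg :: "nat \<Rightarrow> real" where
  "deg i = (\<Sum>j<N. adj i j)"

lemma adj_sym: "adj i j = adj j i"
  using arc_sym by (auto simp: adj_def)

lemma sum_adj:
  "(\<Sum>j<N. adj i j * f j) = (\<Sum>j | (i, j) \<in> parcs T. f j)"
proof -
  have "{j. (i, j) \<in> parcs T} = {j \<in> {..<N}. (i, j) \<in> parcs T}"
    using arc_verts(2)[of i] verts by auto
  then show ?thesis
    by (simp only: sum.inter_filter finite_lessThan) (intro sum.cong, auto simp: adj_def)
qed

lemma deg_eq_card: "deg i = real (card {j. (i, j) \<in> parcs T})"
  using sum_adj[of i "\<lambda>_. 1"] by (simp add: deg_def)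

lemma finite_neighbours: "finite {j. (i, j) \<in> parcs T}"
  using arc_verts(2)[of i] verts by (auto intro: finite_subset[of _ "{0..<N}"])

lemma out_degree_eq_deg: "real (out_degree (with_proj T) i) = deg i"
proof -
  have "out_arcs (with_proj T) i = Pair i ` {j. (i, j) \<in> parcs T}"
    by (auto simp: out_arcs_def)
  then show ?thesis
    by (simp add: out_degree_def deg_eq_card card_image inj_on_def)
qed

lemma laplacian_carrier: "laplacian T \<in> carrier_mat N N"
  using verts
  by (simp add: laplacian_def degree_matrix_def adjacency_matrix_def Let_def mat_diag_def
      minus_carrier_mat)

lemma laplacian_entry:
  assumes "i < N" "j < N"
  shows "laplacian T $$ (i, j) = of_bool (i = j) * deg i - adj i j"
  using assms verts out_degree_eq_deg
  by (auto simp: laplacian_def degree_matrix_def adjacency_matrix_def Let_def mat_diag_def adj_def)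

lemma laplacian_row_mult:
  assumes "i < N"
  shows "(\<Sum>k<N. laplacian T $$ (i, k) * f k) = (\<Sum>k<N. adj i k * (f i - f k))"
proof -
  have "(\<Sum>k<N. laplacian T $$ (i, k) * f k)
      = (\<Sum>k<N. (if k = i then deg i * f i else 0) - adj i k * f k)"
    by (rule sum.cong) (use assms in \<open>auto simp: laplacian_entry algebra_simps\<close>)
  also have "\<dots> = deg i * f i - (\<Sum>k<N. adj i k * f k)"
    using assms by (simp add: sum_subtractf)
  finally show ?thesis
    by (simp add: deg_def sum_distrib_right sum_subtractf right_diff_distrib)
qed

text \<open>
  The quadratic form is half the sum of \<open>(v\<^sub>i - v\<^sub>j)\<^sup>2\<close> over all arcs.
\<close>

lemma laplacian_psd:
  assumes v: "v \<in> carrier_vec N"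
  shows "0 \<le> v \<bullet> (laplacian T *\<^sub>v v)"
proof -
  define q where "q i j = adj i j * (v $ i * (v $ i - v $ j))" for i j
  have "v \<bullet> (laplacian T *\<^sub>v v) = (\<Sum>i<N. v $ i * (laplacian T *\<^sub>v v) $ i)"
    using laplacian_carrier v by (simp add: scalar_prod_def atLeast0LessThan)
  also have "\<dots> = (\<Sum>i<N. v $ i * (\<Sum>k<N. adj i k * (v $ i - v $ k)))"
    by (rule sum.cong)
      (simp_all add: mat_mult_vec_entry[OF laplacian_carrier v] laplacian_row_mult
        del: index_mult_mat_vec)
  also have "\<dots> = (\<Sum>i<N. \<Sum>j<N. q i j)"
    by (simp add: q_def sum_distrib_left mult.left_commute)
  finally have q: "v \<bullet> (laplacian T *\<^sub>v v) = (\<Sum>i<N. \<Sum>j<N. q i j)" .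
  also have "\<dots> = (\<Sum>i<N. \<Sum>j<N. q j i)"
    by (rule sum.swap)
  finally have "2 * (v \<bullet> (laplacian T *\<^sub>v v)) = (\<Sum>i<N. \<Sum>j<N. q i j + q j i)"
    using q by (simp add: sum.distrib)
  also have "\<dots> = (\<Sum>i<N. \<Sum>j<N. adj i j * (v $ i - v $ j)\<^sup>2)"
    by (intro sum.cong refl) (simp add: q_def adj_sym power2_eq_square algebra_simps)
  also have "\<dots> \<ge> 0"
    by (intro sum_nonneg) (simp add: adj_def)
  finally show ?thesis
    by simp
qed

text \<open>
  In row \<open>i\<close> only the differences \<open>D i j - D k j\<close> over the neighbours \<open>k\<close> of \<open>i\<close> matter: one of them is
  \<open>1\<close> and the others are \<open>- 1\<close>, unless \<open>i = j\<close>, where all of them are \<open>- 1\<close>.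
\<close>

lemma laplacian_dist:
  assumes i: "i < N" and j: "j < N"
  shows "(\<Sum>k<N. laplacian T $$ (i, k) * D k j) = 2 - deg i - 2 * of_bool (i = j)"
proof -
  have iV: "i \<in> pverts T" and jV: "j \<in> pverts T"
    using assms verts by auto
  let ?nbr = "{k. (i, k) \<in> parcs T}"
  have eq: "(\<Sum>k<N. laplacian T $$ (i, k) * D k j) = (\<Sum>k\<in>?nbr. real (D i j) - real (D k j))"
    unfolding laplacian_row_mult[OF i] by (rule sum_adj)
  show ?thesis
  proof (cases "i = j")
    case True
    have "(\<Sum>k\<in>?nbr. real (D i j) - real (D k j)) = (\<Sum>k\<in>?nbr. - 1)"
      using True arc_dist[OF arc_sym] dist_self[OF iV] by (intro sum.cong) auto
    then show ?thesis
      using eq True by (simp add: deg_eq_card)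
  next
    case False
    obtain k where k: "(i, k) \<in> parcs T" "D i j = Suc (D k j)"
        "\<And>k'. (i, k') \<in> parcs T \<Longrightarrow> k' \<noteq> k \<Longrightarrow> D k' j = Suc (D i j)"
      using ex_unique_closer[OF iV jV False] by metis
    have "(\<Sum>l\<in>?nbr. real (D i j) - real (D l j))
        = real (D i j) - real (D k j) + (\<Sum>l\<in>?nbr - {k}. real (D i j) - real (D l j))"
      using k(1) finite_neighbours by (subst sum.remove[of _ k]) auto
    also have "(\<Sum>l\<in>?nbr - {k}. real (D i j) - real (D l j)) = (\<Sum>l\<in>?nbr - {k}. - 1)"
      using k(3) by (intro sum.cong) auto
    also have "\<dots> = 1 - deg i"
      using k(1) finite_neighbours[of i] card_gt_0_iff[of ?nbr]
      by (auto simp: deg_eq_card card_Diff_singleton of_nat_diff)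
    finally show ?thesis
      using eq k(2) False by simp
  qed
qed

lemma laplacian_row_sum: "i < N \<Longrightarrow> (\<Sum>j<N. laplacian T $$ (i, j)) = 0"
  using laplacian_row_mult[of i "\<lambda>_. 1"] by simp

lemma laplacian_sym: "i < N \<Longrightarrow> j < N \<Longrightarrow> laplacian T $$ (i, j) = laplacian T $$ (j, i)"
  by (simp add: laplacian_entry adj_sym[of i j])

text \<open>
  The columns of the Laplacian sum to 0, hence so do those of its product with the distance matrix; the
  first column of that product expresses this sum by the degrees.
\<close>

lemma sum_deg: "(\<Sum>i<N. deg i) = 2 * (real N - 1)"
proof -
  have "(\<Sum>i<N. 2 - deg i - 2 * of_bool (i = 0)) = (\<Sum>i<N. \<Sum>k<N. laplacian T $$ (i, k) * D k 0)"
    using N_pos by (simp add: laplacian_dist)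
  also have "\<dots> = (\<Sum>k<N. (\<Sum>i<N. laplacian T $$ (k, i)) * D k 0)"
    by (subst sum.swap) (simp add: sum_distrib_right laplacian_sym)
  also have "\<dots> = 0"
    by (simp add: laplacian_row_sum)
  finally show ?thesis
    using N_pos by (simp add: sum_subtractf sum_distrib_left[symmetric] of_bool_def)
qed

definition row_mean :: "nat \<Rightarrow> real" where
  "row_mean i = (\<Sum>j<N. real (D i j)) / N"

definition total_mean :: real where
  "total_mean = (\<Sum>i<N. row_mean i) / N"

text \<open>
  The doubly centred matrix \<open>- D / 2\<close> plus \<open>J / N\<close>; it inverts \<open>L + J / N\<close>, not the singular \<open>L\<close>.
\<close>

definition laplacian_inverse :: "real mat" where
  "laplacian_inverse =
    mat N N (\<lambda>(i, j). (row_mean i + row_mean j - total_mean - D i j) / 2 + 1 / N)"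

lemma laplacian_inverse_correct:
  "(laplacian T + mat N N (\<lambda>_. 1 / N)) * laplacian_inverse = 1\<^sub>m N"
proof (rule eq_matI)
  fix i j assume "i < dim_row (1\<^sub>m N :: real mat)" and "j < dim_col (1\<^sub>m N :: real mat)"
  then have i: "i < N" and j: "j < N"
    by auto
  let ?L = "\<lambda>i k. laplacian T $$ (i, k)"
  define c where "c = (row_mean j - total_mean) / 2 + 1 / N"
  have Y: "laplacian_inverse $$ (k, j) = row_mean k / 2 - D k j / 2 + c" if "k < N" for k
    using that j by (simp add: laplacian_inverse_def c_def field_simps)
  have "(\<Sum>k<N. ?L i k * row_mean k) = (\<Sum>k<N. \<Sum>m<N. ?L i k * D k m) / N"
    by (simp add: row_mean_def sum_distrib_left sum_divide_distrib)
  also have "\<dots> = (\<Sum>m<N. 2 - deg i - 2 * of_bool (i = m)) / N"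
    by (subst sum.swap) (simp add: laplacian_dist[OF i])
  also have "\<dots> = 2 - deg i - 2 / N"
    using N_pos i by (simp add: sum_subtractf sum_distrib_left[symmetric] of_bool_def field_simps)
  finally have L_mean: "(\<Sum>k<N. ?L i k * row_mean k) = 2 - deg i - 2 / N" .
  have "(\<Sum>k<N. ?L i k * laplacian_inverse $$ (k, j))
      = (\<Sum>k<N. ?L i k * row_mean k / 2 - ?L i k * D k j / 2 + ?L i k * c)"
    by (rule sum.cong) (simp_all add: Y algebra_simps)
  also have "\<dots> = (\<Sum>k<N. ?L i k * row_mean k) / 2 - (\<Sum>k<N. ?L i k * D k j) / 2 + (\<Sum>k<N. ?L i k) * c"
    by (simp add: sum.distrib sum_subtractf sum_divide_distrib sum_distrib_right)
  also have "\<dots> = of_bool (i = j) - 1 / N"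
    unfolding L_mean laplacian_dist[OF i j] laplacian_row_sum[OF i] by (simp add: field_simps)
  finally have L_part: "(\<Sum>k<N. ?L i k * laplacian_inverse $$ (k, j)) = of_bool (i = j) - 1 / N" .
  have "(\<Sum>k<N. real (D k j)) = (\<Sum>k<N. real (D j k))"
    using j verts by (intro sum.cong) (auto intro: dist_sym)
  then have "(\<Sum>k<N. real (D k j)) = N * row_mean j"
    using N_pos by (simp add: row_mean_def)
  moreover have "(\<Sum>k<N. row_mean k) = N * total_mean"
    using N_pos by (simp add: total_mean_def)
  moreover have "(\<Sum>k<N. laplacian_inverse $$ (k, j)) = (\<Sum>k<N. row_mean k / 2 - D k j / 2 + c)"
    by (rule sum.cong) (simp_all add: Y)
  then have "(\<Sum>k<N. laplacian_inverse $$ (k, j))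
      = (\<Sum>k<N. row_mean k) / 2 - (\<Sum>k<N. real (D k j)) / 2 + N * c"
    by (simp add: sum.distrib sum_subtractf sum_divide_distrib)
  ultimately have col: "(\<Sum>k<N. laplacian_inverse $$ (k, j)) = 1"
    using N_pos by (simp add: c_def field_simps)
  have "((laplacian T + mat N N (\<lambda>_. 1 / N)) * laplacian_inverse) $$ (i, j)
      = (\<Sum>k<N. (?L i k + 1 / N) * laplacian_inverse $$ (k, j))"
    using mat_mult_entry[of "laplacian T + mat N N (\<lambda>_. 1 / N)" N laplacian_inverse i j]
      laplacian_carrier i j by (simp add: laplacian_inverse_def)
  also have "\<dots> = of_bool (i = j)"
    using L_part col by (simp add: algebra_simps sum.distrib sum_divide_distrib[symmetric])
  finally show "((laplacian T + mat N N (\<lambda>_. 1 / N)) * laplacian_inverse) $$ (i, j) = 1\<^sub>m N $$ (i, j)"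
    using i j by simp
qed (use laplacian_carrier in \<open>auto simp: laplacian_inverse_def\<close>)

lemma H2_norm_eq_sum_dist:
  "H2_norm T = sqrt ((\<Sum>u\<in>pverts T. \<Sum>v\<in>pverts T. real (D u v)) / (4 * N))"
proof -
  let ?S = "\<Sum>i<N. \<Sum>j<N. real (D i j)"
  have N_total: "N * total_mean = (\<Sum>i<N. row_mean i)" and mean: "(\<Sum>i<N. row_mean i) = ?S / N"
    using N_pos by (simp add: total_mean_def, simp add: row_mean_def sum_divide_distrib)
  have "(\<Sum>i=2..N. 1 / laplacian_eigenvalues T ! (i - 1))
      = (\<Sum>i<N. laplacian_inverse $$ (i, i)) - 1"
    unfolding laplacian_eigenvalues_def
    using laplacian_carrier N_pos laplacian_sym laplacian_psd laplacian_row_sum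
      laplacian_inverse_correct
    by (intro sum_inverse_nonzero_eigenvalues) (auto simp: laplacian_inverse_def)
  also have "(\<Sum>i<N. laplacian_inverse $$ (i, i)) = (\<Sum>i<N. row_mean i - total_mean / 2 + 1 / N)"
    using dist_self verts by (intro sum.cong) (auto simp: laplacian_inverse_def field_simps)
  also have "\<dots> = ?S / (2 * N) + 1"
    using N_pos N_total mean by (simp add: sum.distrib sum_subtractf)
  finally have "(\<Sum>i=2..N. 1 / laplacian_eigenvalues T ! (i - 1)) = ?S / (2 * N)"
    by simp
  moreover have "(\<Sum>i=2..N. 1 / (2 * laplacian_eigenvalues T ! (i - 1)))
      = (\<Sum>i=2..N. 1 / laplacian_eigenvalues T ! (i - 1)) / 2"
    by (simp add: sum_divide_distrib mult.commute)
  ultimately show ?thesis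
    using verts by (simp add: H2_norm_def atLeast0LessThan)
qed

end

section \<open>Lowering the diameter\<close>

definition total_dist :: "'a pair_pre_digraph \<Rightarrow> nat" where
  "total_dist T = (\<Sum>u\<in>pverts T. \<Sum>v\<in>pverts T. tree_dist T u v)"

lemma numbered_tree_tree_dist:
  assumes "T \<in> trees N"
  shows "numbered_tree T (tree_dist T) N"
proof -
  have tree: "undirected_tree T" and V: "pverts T = {0..<N}"
    using assms by (auto simp: trees_def)
  interpret graph_tree_metric T "tree_dist T"
    using undirected_tree_metric[OF tree] .
  have "strongly_connected (mk_symmetric (with_proj T))"
    using tree by (simp add: undirected_tree_def connected_def)
  then have "0 < N"
    using V by (auto simp: strongly_connected_def)
  then show ?thesis
    using V by unfold_locales
qed

lemma H2_norm_tree: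
  assumes "T \<in> trees N"
  shows "H2_norm T = sqrt (real (total_dist T) / (4 * N))"
proof -
  interpret numbered_tree T "tree_dist T" N
    using numbered_tree_tree_dist[OF assms] .
  show ?thesis
    using H2_norm_eq_sum_dist by (simp add: total_dist_def)
qed

lemma tree_dist_le_diameter:
  assumes "finite (pverts T)" "u \<in> pverts T" "v \<in> pverts T"
  shows "tree_dist T u v \<le> tree_diameter T"
proof -
  have "{tree_dist T u v |u v. u \<in> pverts T \<and> v \<in> pverts T}
      = (\<lambda>(u, v). tree_dist T u v) ` (pverts T \<times> pverts T)"
    by auto
  then show ?thesis
    using assms unfolding tree_diameter_def by (intro Max_ge) auto
qed

lemma diameter_attained:
  assumes "finite (pverts T)" "pverts T \<noteq> {}"
  obtains u v where "u \<in> pverts T" "v \<in> pverts T" "tree_dist T u v = tree_diameter T"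
proof -
  have eq: "{tree_dist T u v |u v. u \<in> pverts T \<and> v \<in> pverts T}
      = (\<lambda>(u, v). tree_dist T u v) ` (pverts T \<times> pverts T)"
    by auto
  have "tree_diameter T \<in> {tree_dist T u v |u v. u \<in> pverts T \<and> v \<in> pverts T}"
    unfolding tree_diameter_def by (rule Max_in) (use assms in \<open>auto simp: eq\<close>)
  then show ?thesis
    using that by auto
qed

text \<open>
  On a path of length at least 3 the second edge has no leaf as an end; contract it. The first node \<open>u\<close> of
  the path shows that the side of \<open>x\<close> has another node, and the last node \<open>v\<close> lies beyond \<open>y\<close>.
\<close>

lemma contract_edge:
  assumes T: "T \<in> trees N" and d: "3 \<le> tree_diameter T"
  shows "\<exists>T' \<in> trees N. total_dist T' < total_dist T \<and>
    tree_diameter T' \<le> tree_diameter T \<and> tree_diameter T \<le> Suc (tree_diameter T')"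
proof -
  define D where "D = tree_dist T"
  interpret numbered_tree T D N
    using numbered_tree_tree_dist[OF T] by (simp add: D_def)
  let ?V = "pverts T"
  have fin: "finite ?V" and ne: "?V \<noteq> {}"
    using verts N_pos by auto
  obtain u v where uv: "u \<in> ?V" "v \<in> ?V" "D u v = tree_diameter T"
    using diameter_attained[OF fin ne] unfolding D_def by metis
  then have "u \<noteq> v"
    using d dist_self by auto
  then obtain x where ux: "(u, x) \<in> parcs T" "D u v = Suc (D x v)"
    using closer_neighbour uv by metis
  then have "x \<in> ?V" "x \<noteq> v"
    using arc_verts dist_self uv d by auto
  then obtain y where xyv: "(x, y) \<in> parcs T" "D x v = Suc (D y v)"
    using closer_neighbour uv by metis
  interpret tree_metric_edge ?V "parcs T" D x y
    using xyv by unfold_locales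
  have "y \<noteq> u"
    using ux(2) xyv(2) by auto
  then have "D y u = 2"
    using other_neighbour_farther[of x u y u] arc_sym[OF ux(1)] xyv(1) uv(1) arc_dist[of x u]
      dist_self[OF uv(1)] by simp
  then have u_near: "u \<in> near" "u \<noteq> x"
    using uv(1) arc_dist[OF arc_sym[OF ux(1)]] arc_irrefl ux(1) by (auto simp: near_def)
  have "v \<in> far"
    using uv(2,3) ux xyv d dist_self[of v] by (auto simp: far_def)
  then have less: "(\<Sum>u\<in>?V. \<Sum>v\<in>?V. contracted_dist u v) < (\<Sum>u\<in>?V. \<Sum>v\<in>?V. D u v)"
    using sum_contracted_dist_less[OF fin u_near] by blast

  define T' where "T' = \<lparr>pverts = ?V, parcs = contracted_arcs\<rparr>"
  have V': "pverts T' = ?V" and E': "parcs T' = contracted_arcs"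
    by (simp_all add: T'_def)
  interpret C: tree_metric ?V contracted_arcs contracted_dist
    by (rule tree_metric_contracted)
  have "pair_graph T'"
  proof
    show "fst e \<in> pverts T'" "snd e \<in> pverts T'" if "e \<in> parcs T'" for e
      using that C.arcs_in_verts V' E' by auto
    show "finite (pverts T')" "finite (parcs T')"
      using fin V' E' finite_subset[OF C.arcs_in_verts] by auto
    show "fst e \<noteq> snd e" if "e \<in> parcs T'" for e
      using that C.arc_irrefl E' by (cases e) auto
    show "symmetric (with_proj T')"
      using C.arc_sym E' by (auto simp: symmetric_def intro: symI)
  qed
  then interpret T': graph_tree_metric T' contracted_dist
    using C.tree_metric_axioms V' E' by (simp add: graph_tree_metric_def)
  have dist': "tree_dist T' a b = contracted_dist a b" if "a \<in> ?V" "b \<in> ?V" for a b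
    using T'.tree_dist_eq that V' by simp
  have T'_tree: "T' \<in> trees N"
    using T'.undirected_tree_from_metric ne V' verts by (simp add: trees_def)
  have "total_dist T' < total_dist T"
    using less dist' V' by (simp add: total_dist_def D_def)
  moreover have "tree_diameter T' \<le> tree_diameter T"
  proof -
    obtain a b where ab: "a \<in> ?V" "b \<in> ?V" "contracted_dist a b = tree_diameter T'"
      using diameter_attained[of T'] fin ne V' dist' by metis
    have "D a b \<le> tree_diameter T" if "a \<in> ?V" "b \<in> ?V" for a b
      using tree_dist_le_diameter[OF fin that] by (simp add: D_def)
    then show ?thesis
      using contracted_dist_bounds(2)[OF ab(1,2)] ab by (metis order_trans)
  qed
  moreover have "tree_diameter T \<le> Suc (tree_diameter T')"
    using contracted_dist_bounds(1)[OF uv(1,2)] uv dist' V'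
      tree_dist_le_diameter[of T' u v] fin by simp
  ultimately show ?thesis
    using T'_tree by blast
qed

text \<open>
  One contraction may leave the diameter unchanged, since a longest path can avoid the contracted
  edge. The distance sum decreases every time, so the repetition ends.
\<close>

lemma reduce_diameter:
  assumes "T \<in> trees N" and "3 \<le> tree_diameter T"
  shows "\<exists>T' \<in> trees N. total_dist T' < total_dist T \<and> tree_diameter T = Suc (tree_diameter T')"
  using assms
proof (induction "total_dist T" arbitrary: T rule: less_induct)
  case less
  then obtain T1 where T1: "T1 \<in> trees N" "total_dist T1 < total_dist T"
      "tree_diameter T1 \<le> tree_diameter T" "tree_diameter T \<le> Suc (tree_diameter T1)"
    using contract_edge by blast
  show ?case
  proof (cases "tree_diameter T1 = tree_diameter T")
    case True
    then show ?thesis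
      using less.hyps[OF T1(2,1)] less.prems T1(2) by (metis less_trans)
  next
    case False
    then show ?thesis
      using T1 by (intro bexI[of _ T1]) auto
  qed
qed

section \<open>The star minimises the distance sum\<close>

context numbered_tree
begin

lemma card_arcs: "card (parcs T) = 2 * (N - 1)"
proof -
  have "parcs T = Sigma {..<N} (\<lambda>i. {j. (i, j) \<in> parcs T})"
    using arcs_in_verts verts by auto
  then have "card (parcs T) = (\<Sum>i<N. card {j. (i, j) \<in> parcs T})"
    using card_SigmaI[of "{..<N}" "\<lambda>i. {j. (i, j) \<in> parcs T}"] finite_neighbours by simp
  then have "real (card (parcs T)) = 2 * (real N - 1)"
    using sum_deg by (simp add: deg_eq_card)
  also have "\<dots> = real (2 * (N - 1))"
    using N_pos by (simp add: of_nat_diff)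
  finally show ?thesis
    by (simp only: of_nat_eq_iff)
qed

text \<open>
  Adjacent pairs contribute 1 each and equal pairs nothing, so only the nonadjacent pairs can
  distinguish two trees with the same number of nodes.
\<close>

lemma sum_pairwise_dist:
  "(\<Sum>u\<in>pverts T. \<Sum>v\<in>pverts T. D u v) =
    2 * (N - 1) + (\<Sum>(u, v) \<in> {(u, v) \<in> pverts T \<times> pverts T - parcs T. u \<noteq> v}. D u v)"
proof -
  let ?V = "pverts T"
  let ?R = "{(u, v) \<in> ?V \<times> ?V - parcs T. u \<noteq> v}"
  have fin: "finite (?V \<times> ?V)"
    using verts by simp
  have "(\<Sum>u\<in>?V. \<Sum>v\<in>?V. D u v) = (\<Sum>(u, v)\<in>?V \<times> ?V. D u v)"
    by (rule sum.cartesian_product)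
  also have "\<dots> = (\<Sum>(u, v)\<in>parcs T \<union> ?R. D u v)"
    by (rule sum.mono_neutral_right) (use fin arcs_in_verts dist_self in auto)
  also have "\<dots> = (\<Sum>(u, v)\<in>parcs T. D u v) + (\<Sum>(u, v)\<in>?R. D u v)"
    by (rule sum.union_disjoint)
      (use finite_subset[OF arcs_in_verts fin] finite_subset[OF _ fin, of ?R] in auto)
  also have "(\<Sum>(u, v)\<in>parcs T. D u v) = (\<Sum>(u, v)\<in>parcs T. 1)"
    by (rule sum.cong) (auto simp: arc_dist)
  finally show ?thesis
    using card_arcs by (simp add: split_def)
qed

lemma card_nonadjacent: "card {(u, v) \<in> pverts T \<times> pverts T - parcs T. u \<noteq> v} = (N - 1) * (N - 2)"
proof -
  let ?V = "pverts T"
  let ?R = "{(u, v) \<in> ?V \<times> ?V - parcs T. u \<noteq> v}"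
  have fin: "finite (?V \<times> ?V)"
    using verts by simp
  have finE: "finite (parcs T)" and finR: "finite ?R"
    using finite_subset[OF arcs_in_verts fin] finite_subset[OF _ fin, of ?R] by auto
  have "?V \<times> ?V = (parcs T \<union> ?R) \<union> (\<lambda>v. (v, v)) ` ?V"
    using arcs_in_verts by auto
  also have "card \<dots> = card (parcs T \<union> ?R) + card ((\<lambda>v. (v, v)) ` ?V)"
    by (rule card_Un_disjoint) (use finE finR verts arc_irrefl in auto)
  also have "card (parcs T \<union> ?R) = card (parcs T) + card ?R"
    by (rule card_Un_disjoint) (use finE finR in auto)
  also have "card ((\<lambda>v. (v, v)) ` ?V) = N"
    using verts by (simp add: card_image inj_on_def)
  finally have "N * N = 2 * (N - 1) + card ?R + N"
    using verts card_arcs by (simp add: card_cartesian_product)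
  moreover have "N * N = 2 * (N - 1) + (N - 1) * (N - 2) + N"
    using N_pos by (cases N; cases "N - 1") (auto simp: algebra_simps)
  ultimately show ?thesis
    by linarith
qed

lemma nonadjacent_dist_ge_2:
  assumes "u \<in> pverts T" "v \<in> pverts T" "(u, v) \<notin> parcs T" "u \<noteq> v"
  shows "2 \<le> D u v"
proof -
  obtain w where "(u, w) \<in> parcs T" "D u v = Suc (D w v)"
    using closer_neighbour assms by blast
  moreover from this have "D w v \<noteq> 0"
    using dist_eq_0_iff assms arc_verts by blast
  ultimately show ?thesis
    by simp
qed

end

lemma total_dist_ge:
  assumes "T \<in> trees N"
  shows "2 * (N - 1) * (N - 1) \<le> total_dist T"
proof -
  interpret numbered_tree T "tree_dist T" N
    using numbered_tree_tree_dist[OF assms] .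
  let ?R = "{(u, v) \<in> pverts T \<times> pverts T - parcs T. u \<noteq> v}"
  have "2 * ((N - 1) * (N - 2)) = (\<Sum>(u, v)\<in>?R. 2)"
    using card_nonadjacent by (simp add: split_def)
  also have "\<dots> \<le> (\<Sum>(u, v)\<in>?R. tree_dist T u v)"
    by (rule sum_mono) (use nonadjacent_dist_ge_2 in auto)
  finally show ?thesis
    using sum_pairwise_dist N_pos unfolding total_dist_def
    by (cases N; cases "N - 1") (auto simp: algebra_simps)
qed

lemma total_dist_star:
  assumes "is_star N S"
  shows "total_dist S = 2 * (N - 1) * (N - 1)"
proof -
  interpret numbered_tree S "tree_dist S" N
    using numbered_tree_tree_dist[OF is_star_tree[OF assms]] .
  obtain U W where UW: "pverts S = U \<union> W" "card U = 1" "parcs S = U \<times> W \<union> W \<times> U"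
    using assms unfolding is_star_def complete_bipartite_digraph_pair_def by blast
  then obtain c where cW: "pverts S = {c} \<union> W" "parcs S = {c} \<times> W \<union> W \<times> {c}"
    by (metis card_1_singletonE)
  let ?R = "{(u, v) \<in> pverts S \<times> pverts S - parcs S. u \<noteq> v}"
  have "tree_dist S u v = 2" if "(u, v) \<in> ?R" for u v
  proof -
    have "(u, c) \<in> parcs S" "(c, v) \<in> parcs S"
      using that cW by auto
    then have "tree_dist S u v \<le> 2"
      using arc_dist_cases[of u c v] arc_dist[of c v] that by auto
    then show ?thesis
      using nonadjacent_dist_ge_2[of u v] that by auto
  qed
  then have "(\<Sum>(u, v)\<in>?R. tree_dist S u v) = (\<Sum>(u, v)\<in>?R. 2)"
    by (intro sum.cong) auto
  then show ?thesis
    using sum_pairwise_dist N_pos card_nonadjacent unfolding total_dist_def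
    by (cases N; cases "N - 1") (auto simp: algebra_simps split_def)
qed

section \<open>The minimal norm\<close>

theorem theorem5:
  shows "(\<forall>N d :: nat. 3 \<le> d \<and> d \<le> N - 1 \<longrightarrow>
            (\<forall>T \<in> trees_diam N d. \<exists>T' \<in> trees_diam N (d - 1). H2_norm T' < H2_norm T))
       \<and> (\<forall>N S T. is_star N S \<and> T \<in> trees N \<longrightarrow> H2_norm S \<le> H2_norm T)"
proof (intro conjI allI impI ballI)
  fix N d :: nat and T
  assume d: "3 \<le> d \<and> d \<le> N - 1" and T: "T \<in> trees_diam N d"
  then obtain T' where "T' \<in> trees N" "total_dist T' < total_dist T" "d = Suc (tree_diameter T')"
    using reduce_diameter[of T N] by (auto simp: trees_diam_def)
  then show "\<exists>T' \<in> trees_diam N (d - 1). H2_norm T' < H2_norm T"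
    using d T by (intro bexI[of _ T']) (auto simp: trees_diam_def H2_norm_tree divide_strict_right_mono)
next
  fix N and S T :: "nat pair_pre_digraph"
  assume *: "is_star N S \<and> T \<in> trees N"
  then have "total_dist S \<le> total_dist T"
    using total_dist_ge[of T N] total_dist_star[of N S] by simp
  then show "H2_norm S \<le> H2_norm T"
    using * is_star_tree[of N S] by (auto simp: H2_norm_tree divide_right_mono)
qed

end
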